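(* Let $\beta,\gamma>0$, $n\in\mathbb{N}$, $\delta\in(0,1/4]$, let $\Theta:=\mathcal{F}(\beta,\gamma)$ be the Hölder class of density functions and for $f\in\Theta$, define $\mathcal{P}_f:=\{P_f^{\otimes n}\}$ where $P_f$ is the distribution on $\mathbb{R}$ with density $f$. Fix $x_0\in\mathbb{R}$ and let $L(f_1,f_2):=\{f_1(x_0)-f_2(x_0)\}^2$. Then $$\mathcal{M}(\delta,\mathcal{P}_\Theta,L)\asymp_\beta\gamma^{2/(\beta+1)}\cdot\min\biggl\{\biggl(\frac{\log(1/\delta)}{n}\biggr)^{2\beta/(2\beta+1)},\ 1\biggr\}.$$
   Context: Hölder class: for $\beta,\gamma>0$ and $m:=\lceil\beta\rceil-1$, $\mathcal{F}(\beta,\gamma)$ is the set of all Borel measurable functions $f:\mathbb{R}\to[0,\infty)$ such that $\int_{-\infty}^\infty f(x)\,dx=1$, $f$ is $m$-times differentiable, and $|f^{(m)}(x)-f^{(m)}(x')|\le\gamma|x-x'|^{\beta-m}$ for all $x,x'\in\mathbb{R}$. $\Theta$ is regarded as a pseudo-metric space with pseudo-metric $(f_1,f_2)\mapsto|f_1(x_0)-f_2(x_0)|$, with the induced topology and Borel $\sigma$-algebra. For a pseudo-metric space $\Theta$ of parameters, a family $\mathcal{P}_\Theta=\{\mathcal{P}_\theta:\theta\in\Theta\}$ where each $\mathcal{P}_\theta$ is a set of probability measures on a measurable space $\mathcal{X}$, and a loss $L:\Theta\times\Theta\to[0,\infty)$, the minimax $(1-\delta)$th quantile is $$\mathcal{M}(\delta,\mathcal{P}_\Theta,L):=\inf_{\hat\theta}\sup_{\theta\in\Theta}\sup_{P_\theta\in\mathcal{P}_\theta}\inf\{r\in[0,\infty):P_\theta\{L(\hat\theta,\theta)\le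 r\}\ge1-\delta\},$$ where the first infimum is over all measurable functions $\hat\theta:\mathcal{X}\to\Theta$ (which may depend on $\delta$). Here $\mathcal{X}=\mathbb{R}^n$. $a\asymp_\beta b$ means that there are constants $c(\beta),C(\beta)>0$ depending only on $\beta$ (and not on $\gamma,n,\delta,x_0$) with $c(\beta)b\le a\le C(\beta)b$. *)

theory Defs
  imports "HOL-Probability.Probability"
begin

definition pseudometric_topology :: "'t set \<Rightarrow> ('t \<Rightarrow> 't \<Rightarrow> real) \<Rightarrow> 't topology" where
  "pseudometric_topology \<Theta> d =
     topology (\<lambda>U. U \<subseteq> \<Theta> \<and> (\<forall>s\<in>U. \<exists>e>0. \<forall>t\<in>\<Theta>. d s t < e \<longrightarrow> t \<in> U))"

lemma openin_pseudometric_topology: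
  "openin (pseudometric_topology \<Theta> d) U \<longleftrightarrow>
     U \<subseteq> \<Theta> \<and> (\<forall>s\<in>U. \<exists>e>0. \<forall>t\<in>\<Theta>. d s t < e \<longrightarrow> t \<in> U)"
proof -
  let ?P = "\<lambda>U. U \<subseteq> \<Theta> \<and> (\<forall>s\<in>U. \<exists>e>0. \<forall>t\<in>\<Theta>. d s t < e \<longrightarrow> t \<in> U)"
  have "istopology ?P"
    unfolding istopology_def
  proof (intro conjI allI impI)
    fix S T assume S: "?P S" and T: "?P T"
    then show "S \<inter> T \<subseteq> \<Theta>" by blast
    show "\<forall>s\<in>S \<inter> T. \<exists>e>0. \<forall>t\<in>\<Theta>. d s t < e \<longrightarrow> t \<in> S \<inter> T"
    proof
      fix s assume "s \<in> S \<inter> T"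
      with S T obtain e1 e2 where "e1 > 0" "\<forall>t\<in>\<Theta>. d s t < e1 \<longrightarrow> t \<in> S"
        and "e2 > 0" "\<forall>t\<in>\<Theta>. d s t < e2 \<longrightarrow> t \<in> T" by blast
      then show "\<exists>e>0. \<forall>t\<in>\<Theta>. d s t < e \<longrightarrow> t \<in> S \<inter> T"
        by (intro exI[of _ "min e1 e2"]) auto
    qed
  next
    fix \<K> assume K: "\<forall>S\<in>\<K>. ?P S"
    then show "\<Union>\<K> \<subseteq> \<Theta>" by blast
    show "\<forall>s\<in>\<Union>\<K>. \<exists>e>0. \<forall>t\<in>\<Theta>. d s t < e \<longrightarrow> t \<in> \<Union>\<K>"
      using K by (meson UnionE UnionI)
  qed
  then show ?thesis
    unfolding pseudometric_topology_def by (simp add: topology_inverse')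
qed

definition pseudometric_borel :: "'t set \<Rightarrow> ('t \<Rightarrow> 't \<Rightarrow> real) \<Rightarrow> 't measure" where
  "pseudometric_borel \<Theta> d = sigma \<Theta> {U. openin (pseudometric_topology \<Theta> d) U}"

text \<open>The infimum is taken in \<^typ>\<open>ennreal\<close>, so that it is \<open>\<infinity>\<close> over the empty set.\<close>

definition quantile :: "real \<Rightarrow> 'x measure \<Rightarrow> ('x \<Rightarrow> real) \<Rightarrow> ennreal" where
  "quantile \<delta> P Z =
     Inf (ennreal ` {r. 0 \<le> r \<and> measure P {x \<in> space P. Z x \<le> r} \<ge> 1 - \<delta>})"

definition minimax_quantile ::
  "real \<Rightarrow> 'x measure \<Rightarrow> 't set \<Rightarrow> ('t \<Rightarrow> 't \<Rightarrow> real) \<Rightarrow> ('t \<Rightarrow> 'x measure set)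
     \<Rightarrow> ('t \<Rightarrow> 't \<Rightarrow> real) \<Rightarrow> ennreal" where
  "minimax_quantile \<delta> X \<Theta> d \<P> L =
     (INF est \<in> measurable X (pseudometric_borel \<Theta> d).
        SUP \<theta>\<in>\<Theta>. SUP P\<in>\<P> \<theta>. quantile \<delta> P (\<lambda>x. L (est x) \<theta>))"

definition holder_densities :: "real \<Rightarrow> real \<Rightarrow> (real \<Rightarrow> real) set" where
  "holder_densities \<beta> \<gamma> =
     (let m = nat (\<lceil>\<beta>\<rceil> - 1) in
      {f. f \<in> borel_measurable borel \<and> (\<forall>x. 0 \<le> f x) \<and> has_bochner_integral lborel f 1 \<and>
          (\<forall>k<m. \<forall>x. (deriv ^^ k) f differentiable at x) \<and>
          (\<forall>x x'. \<bar>(deriv ^^ m) f x - (deriv ^^ m) f x'\<bar> \<le> \<gamma> * \<bar>x - x'\<bar> powr (\<beta> - real m))})"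

definition sample_space :: "nat \<Rightarrow> (nat \<Rightarrow> real) measure" where
  "sample_space n = (\<Pi>\<^sub>M i\<in>{..<n}. borel)"

definition iid_sample :: "nat \<Rightarrow> (real \<Rightarrow> real) \<Rightarrow> (nat \<Rightarrow> real) measure" where
  "iid_sample n f = (\<Pi>\<^sub>M i\<in>{..<n}. density lborel (\<lambda>x. ennreal (f x)))"

end

theory Submission
  imports Defs "HOL-Computational_Algebra.Polynomial"
begin

text \<open>
  Upper bound: summing \<open>f\<close> along an arithmetic progression with alternating coefficients gives a finite
  difference of order \<open>\<lceil>\<beta>\<rceil>\<close>, which is at most \<open>\<gamma> t powr \<beta>\<close>; averaging over the step \<open>t\<close> yields a piecewise
  constant kernel with bias of order \<open>\<gamma> h powr \<beta>\<close>. The same inequality bounds all densities of the class by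
  a multiple of \<open>\<gamma> powr (1 / (\<beta> + 1))\<close>, so a Chernoff bound with the resulting variance controls the kernel
  estimator. Its value is rounded to a grid, and to each grid point a nearby member of the class is
  attached; the resulting estimator takes countably many values and is therefore measurable.

  Lower bound: a wide Gaussian density is compared with its perturbation by
  \<open>a (2 g\<^bsub>h/2\<^esub> - g\<^bsub>h\<^esub>)\<close>, where \<open>g\<^bsub>s\<^esub> x = exp (- ((x - x0) / s)\<^sup>2)\<close>. The chi-square divergence is of
  order \<open>ln (1 / \<delta>) / n\<close>, and Cauchy--Schwarz excludes an event with probability at least \<open>1 - \<delta>\<close> under
  one hypothesis and at most \<open>\<delta>\<close> under the other, up to and including \<open>\<delta> = 1 / 4\<close>.
\<close>

subsection \<open>Membership in the class\<close>

lemma iterated_deriv_eqI: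
  assumes "\<And>k x. k < m \<Longrightarrow> (D k has_real_derivative D (Suc k) x) (at x)"
  shows "k \<le> m \<Longrightarrow> (deriv ^^ k) (D 0) = D k"
proof (induction k)
  case (Suc k)
  have "deriv (D k) = D (Suc k)"
    using assms[of k] Suc.prems by (auto intro!: ext DERIV_imp_deriv)
  then show ?case using Suc by simp
qed simp

lemma holder_densities_derivatives:
  assumes "f \<in> holder_densities \<beta> \<gamma>" "k < nat (\<lceil>\<beta>\<rceil> - 1)"
  shows "((deriv ^^ k) f has_real_derivative (deriv ^^ Suc k) f x) (at x)"
  using assms by (auto simp: holder_densities_def Let_def DERIV_deriv_iff_real_differentiable)

lemma holder_densities_holder:
  assumes "f \<in> holder_densities \<beta> \<gamma>"
  defines "m \<equiv> nat (\<lceil>\<beta>\<rceil> - 1)"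
  shows "\<bar>(deriv ^^ m) f x - (deriv ^^ m) f y\<bar> \<le> \<gamma> * \<bar>x - y\<bar> powr (\<beta> - real m)"
  using assms by (auto simp: holder_densities_def Let_def)

text \<open>An explicit family \<open>D\<close> of successive derivatives stands in for the iterates
  of \<open>deriv\<close>, so that membership of a concrete density reduces to pointwise
  differentiation rules and one Hoelder estimate.\<close>

lemma holder_densitiesI:
  assumes D0: "D 0 = f"
    and D: "\<And>k x. (D k has_real_derivative D (Suc k) x) (at x)"
    and nonneg: "\<And>x. 0 \<le> f x"
    and int: "has_bochner_integral lborel f 1"
    and holder: "\<And>x y. \<bar>D (nat (\<lceil>\<beta>\<rceil> - 1)) x - D (nat (\<lceil>\<beta>\<rceil> - 1)) y\<bar>
      \<le> \<gamma> * \<bar>x - y\<bar> powr (\<beta> - real (nat (\<lceil>\<beta>\<rceil> - 1)))"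
  shows "f \<in> holder_densities \<beta> \<gamma>"
proof -
  have eq: "(deriv ^^ k) f = D k" for k
    using iterated_deriv_eqI[of k D k] D D0 by auto
  have "(deriv ^^ k) f differentiable at x" for k x
    using D unfolding eq real_differentiable_def by blast
  then show ?thesis
    using nonneg int holder borel_measurable_has_bochner_integral[OF int]
    by (simp add: holder_densities_def Let_def eq)
qed

text \<open>The top derivative has Hoelder exponent in (0, 1]; the value 1 occurs because m is one
  less than the ceiling, so integer \<beta> gives a Lipschitz condition.\<close>

lemma ceiling_exponent:
  assumes "\<beta> > 0"
  shows "0 < \<beta> - real (nat (\<lceil>\<beta>\<rceil> - 1))" "\<beta> - real (nat (\<lceil>\<beta>\<rceil> - 1)) \<le> 1"
  using assms by (auto simp: of_nat_nat) linarith+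

subsection \<open>Finite differences\<close>

text \<open>For j up to \<open>Suc m\<close> this is the coefficient of z^j in (1 - z) times the
  polynomial with coefficients c 0, ..., c m. Multiplication by 1 - z corresponds to one further
  difference g j - g (j + 1).\<close>

definition diff_coeffs :: "nat \<Rightarrow> (nat \<Rightarrow> real) \<Rightarrow> nat \<Rightarrow> real" where
  "diff_coeffs m c j = (if j \<le> m then c j else 0) - (if j = 0 then 0 else c (j - 1))"

lemma sum_diff_coeffs:
  "(\<Sum>j\<le>Suc m. diff_coeffs m c j * g j) = (\<Sum>j\<le>m. c j * (g j - g (Suc j)))"
proof -
  have "(\<Sum>j\<le>Suc m. diff_coeffs m c j * g j) = (\<Sum>j\<le>Suc m. (if j \<le> m then c j else 0) * g j)
      - (\<Sum>j\<le>Suc m. (if j = 0 then 0 else c (j - 1)) * g j)"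
    by (simp only: diff_coeffs_def left_diff_distrib sum_subtractf)
  also have "(\<Sum>j\<le>Suc m. (if j = 0 then 0 else c (j - 1)) * g j) = (\<Sum>j\<le>m. c j * g (Suc j))"
    by (subst sum.atMost_Suc_shift) simp
  finally show ?thesis by (simp add: right_diff_distrib sum_subtractf)
qed

text \<open>Induction on the order: the hypothesis is applied to the family y \<mapsto> D k y - D k
  (y + t), and the mean value theorem turns the remaining increment of \<open>D m\<close> into - t
  times a value of \<open>D (Suc m)\<close>. The coefficients are chosen before D, t and x, hence
  depend on m alone.\<close>

lemma finite_difference_mean_value:
  "\<exists>c :: nat \<Rightarrow> real. c 0 = 1 \<and> (\<forall>(D :: nat \<Rightarrow> real \<Rightarrow> real) t x. t > 0 \<longrightarrow>
     (\<forall>k<m. \<forall>y. (D k has_real_derivative D (Suc k) y) (at y)) \<longrightarrow>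
     (\<exists>\<xi>. (\<Sum>j\<le>m. c j * D 0 (x + real j * t)) = (- t) ^ m * D m \<xi>))"
proof (induction m)
  case 0
  show ?case by (intro exI[of _ "\<lambda>_. 1"]) auto
next
  case (Suc m)
  obtain c :: "nat \<Rightarrow> real" where c_all: "c 0 = 1 \<and> (\<forall>(D :: nat \<Rightarrow> real \<Rightarrow> real) t x. t > 0 \<longrightarrow>
     (\<forall>k<m. \<forall>y. (D k has_real_derivative D (Suc k) y) (at y)) \<longrightarrow>
     (\<exists>\<xi>. (\<Sum>j\<le>m. c j * D 0 (x + real j * t)) = (- t) ^ m * D m \<xi>))"
    using Suc.IH by (elim exE that)
  note c0 = c_all[THEN conjunct1] and c = c_all[THEN conjunct2, rule_format]
  show ?case
  proof (intro exI[of _ "diff_coeffs m c"] conjI allI impI)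
    show "diff_coeffs m c 0 = 1" by (simp add: diff_coeffs_def c0)
  next
    fix D :: "nat \<Rightarrow> real \<Rightarrow> real" and t x :: real
    assume t: "t > 0" and D: "\<forall>k<Suc m. \<forall>y. (D k has_real_derivative D (Suc k) y) (at y)"
    have "\<exists>\<xi>. (\<Sum>j\<le>m. c j * (D 0 (x + real j * t) - D 0 ((x + real j * t) + t)))
        = (- t) ^ m * (D m \<xi> - D m (\<xi> + t))"
    proof (rule c[OF t, where D = "\<lambda>k y. D k y - D k (y + t)"])
      fix k y assume "k < m"
      then have *: "(D k has_real_derivative D (Suc k) z) (at z)" for z using D by auto
      show "((\<lambda>y. D k y - D k (y + t)) has_real_derivative D (Suc k) y - D (Suc k) (y + t)) (at y)"
        by (rule DERIV_diff[OF * DERIV_shift[THEN iffD1, OF *]])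
    qed
    then obtain \<xi> where \<xi>: "(\<Sum>j\<le>m. c j * (D 0 (x + real j * t) - D 0 ((x + real j * t) + t)))
        = (- t) ^ m * (D m \<xi> - D m (\<xi> + t))" by blast
    obtain \<eta> where \<eta>: "D m (\<xi> + t) - D m \<xi> = (\<xi> + t - \<xi>) * D (Suc m) \<eta>"
      using MVT2[of \<xi> "\<xi> + t" "D m" "D (Suc m)"] D t by auto
    have "(\<Sum>j\<le>Suc m. diff_coeffs m c j * D 0 (x + real j * t)) = (- t) ^ m * (D m \<xi> - D m (\<xi> + t))"
      unfolding sum_diff_coeffs \<xi>[symmetric] by (simp add: algebra_simps)
    also have "\<dots> = (- t) ^ Suc m * D (Suc m) \<eta>"
    proof -
      have "D m \<xi> - D m (\<xi> + t) = - t * D (Suc m) \<eta>" using \<eta> by simp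
      then show ?thesis by simp
    qed
    finally show "\<exists>\<xi>. (\<Sum>j\<le>Suc m. diff_coeffs m c j * D 0 (x + real j * t)) = (- t) ^ Suc m * D (Suc m) \<xi>"
      by blast
  qed
qed

text \<open>A difference of order m + 1 is used although there are only m derivatives: m of the
  differences become a factor t^m and an m-th derivative, and the last one stays an increment of
  that derivative, to which the Hoelder condition applies. As the coefficient at j = 0 is 1, f x is
  compared with values strictly to its right.\<close>

lemma holder_finite_difference:
  assumes "\<beta> > 0"
  defines "m \<equiv> nat (\<lceil>\<beta>\<rceil> - 1)"
  shows "\<exists>c :: nat \<Rightarrow> real. \<forall>\<gamma> f t x. f \<in> holder_densities \<beta> \<gamma> \<longrightarrow> t > 0 \<longrightarrow>
     \<bar>f x - (\<Sum>j=1..Suc m. c j * f (x + real j * t))\<bar> \<le> \<gamma> * t powr \<beta>"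
proof -
  obtain c :: "nat \<Rightarrow> real" where c_all: "c 0 = 1 \<and> (\<forall>(D :: nat \<Rightarrow> real \<Rightarrow> real) t x. t > 0 \<longrightarrow>
     (\<forall>k<m. \<forall>y. (D k has_real_derivative D (Suc k) y) (at y)) \<longrightarrow>
     (\<exists>\<xi>. (\<Sum>j\<le>m. c j * D 0 (x + real j * t)) = (- t) ^ m * D m \<xi>))"
    using finite_difference_mean_value[of m] by (elim exE that)
  note c0 = c_all[THEN conjunct1] and c = c_all[THEN conjunct2, rule_format]
  show ?thesis
  proof (intro exI[of _ "\<lambda>j. - diff_coeffs m c j"] allI impI)
    fix \<gamma> t x :: real and f assume f: "f \<in> holder_densities \<beta> \<gamma>" and t: "t > 0"
    define D where "D k = (deriv ^^ k) f" for k
    have "\<exists>\<xi>. (\<Sum>j\<le>m. c j * (D 0 (x + real j * t) - D 0 ((x + real j * t) + t)))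
        = (- t) ^ m * (D m \<xi> - D m (\<xi> + t))"
    proof (rule c[OF t, where D = "\<lambda>k y. D k y - D k (y + t)"])
      fix k y assume "k < m"
      then have *: "(D k has_real_derivative D (Suc k) z) (at z)" for z
        using holder_densities_derivatives[OF f, of k] by (simp add: D_def m_def)
      show "((\<lambda>y. D k y - D k (y + t)) has_real_derivative D (Suc k) y - D (Suc k) (y + t)) (at y)"
        by (rule DERIV_diff[OF * DERIV_shift[THEN iffD1, OF *]])
    qed
    then obtain \<xi> where \<xi>: "(\<Sum>j\<le>m. c j * (f (x + real j * t) - f ((x + real j * t) + t)))
        = (- t) ^ m * (D m \<xi> - D m (\<xi> + t))" by (auto simp: D_def)
    have eq: "(\<Sum>j\<le>Suc m. diff_coeffs m c j * f (x + real j * t)) = (- t) ^ m * (D m \<xi> - D m (\<xi> + t))"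
      unfolding sum_diff_coeffs \<xi>[symmetric] by (simp add: algebra_simps)
    have "diff_coeffs m c 0 = 1" "{..Suc m} = insert 0 {1..Suc m}"
      by (auto simp: diff_coeffs_def c0)
    then have "f x - (\<Sum>j=1..Suc m. - diff_coeffs m c j * f (x + real j * t))
        = (\<Sum>j\<le>Suc m. diff_coeffs m c j * f (x + real j * t))"
      by (simp add: sum_negf del: sum.cl_ivl_Suc)
    then have "\<bar>f x - (\<Sum>j=1..Suc m. - diff_coeffs m c j * f (x + real j * t))\<bar>
        = t ^ m * \<bar>D m \<xi> - D m (\<xi> + t)\<bar>"
      using t unfolding eq by (simp add: abs_mult power_abs)
    also have "\<dots> \<le> t ^ m * (\<gamma> * \<bar>\<xi> - (\<xi> + t)\<bar> powr (\<beta> - real m))"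
      using t unfolding D_def m_def by (intro mult_left_mono holder_densities_holder[OF f]) auto
    also have "\<dots> = \<gamma> * (t powr real m * t powr (\<beta> - real m))"
      using t by (simp add: powr_realpow)
    also have "\<dots> = \<gamma> * t powr \<beta>"
      using t by (simp add: powr_add[symmetric])
    finally show "\<bar>f x - (\<Sum>j=1..Suc m. - diff_coeffs m c j * f (x + real j * t))\<bar> \<le> \<gamma> * t powr \<beta>" .
  qed
qed

subsection \<open>Gaussians\<close>

text \<open>Up to the sign (-1)^k these are the Hermite polynomials: the k-th derivative of exp (-
  y^2) is \<open>gauss_poly k\<close> times exp (- y^2).\<close>

fun gauss_poly :: "nat \<Rightarrow> real poly" where
  "gauss_poly 0 = 1"
| "gauss_poly (Suc k) = pderiv (gauss_poly k) - [:0, 2:] * gauss_poly k"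

definition gauss_deriv :: "real \<Rightarrow> real \<Rightarrow> nat \<Rightarrow> real \<Rightarrow> real" where
  "gauss_deriv s x0 k x = poly (gauss_poly k) ((x - x0) / s) * exp (- ((x - x0) / s)\<^sup>2) / s ^ k"

lemma gauss_deriv_has_derivative:
  assumes "s > 0"
  shows "(gauss_deriv s x0 k has_real_derivative gauss_deriv s x0 (Suc k) x) (at x)"
proof -
  define u where "u y = (y - x0) / s" for y
  have u: "(u has_real_derivative 1 / s) (at x)"
    unfolding u_def using assms by (auto intro!: derivative_eq_intros)
  have p: "((\<lambda>y. poly (gauss_poly k) (u y)) has_real_derivative
      poly (pderiv (gauss_poly k)) (u x) * (1 / s)) (at x)"
    by (rule DERIV_chain2[OF poly_DERIV u])
  have e: "((\<lambda>y. exp (- (u y)\<^sup>2)) has_real_derivative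
      exp (- (u x)\<^sup>2) * (- (2 * u x * (1 / s)))) (at x)"
    by (auto intro!: derivative_eq_intros u)
  show ?thesis
    unfolding gauss_deriv_def u_def[symmetric]
    using assms by (auto intro!: DERIV_cong[OF DERIV_cdivide[OF DERIV_mult[OF p e]]] simp: field_simps)
qed

text \<open>Each monomial is dominated by a multiple of exp \<bar>y\<bar>, read off a single term of
  the exponential series, and \<bar>y\<bar> - y^2 is bounded above.\<close>

lemma gauss_poly_exp_bounded:
  "\<exists>B. \<forall>y. \<bar>poly p y * exp (- y\<^sup>2)\<bar> \<le> (B :: real)"
proof -
  have mon: "\<bar>y\<bar> ^ j * exp (- y\<^sup>2) \<le> fact j * exp 1" for y :: real and j
  proof -
    have "(\<Sum>n\<in>{j}. \<bar>y\<bar> ^ n /\<^sub>R fact n) \<le> (\<Sum>n. \<bar>y\<bar> ^ n /\<^sub>R fact n)"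
      by (intro sum_le_suminf summable_exp_generic) auto
    then have le: "\<bar>y\<bar> ^ j \<le> fact j * exp \<bar>y\<bar>"
      by (simp add: exp_def divide_simps mult.commute)
    have "0 \<le> (\<bar>y\<bar> - 1)\<^sup>2" "0 \<le> y\<^sup>2" by simp_all
    then have "\<bar>y\<bar> - y\<^sup>2 \<le> 1"
      unfolding power2_diff power2_abs by simp
    have "\<bar>y\<bar> ^ j * exp (- y\<^sup>2) \<le> fact j * exp \<bar>y\<bar> * exp (- y\<^sup>2)"
      using le by (intro mult_right_mono) auto
    also have "\<dots> = fact j * exp (\<bar>y\<bar> - y\<^sup>2)"
      by (simp add: exp_diff exp_minus divide_inverse)
    also have "\<dots> \<le> fact j * exp 1"
      using \<open>\<bar>y\<bar> - y\<^sup>2 \<le> 1\<close> by (intro mult_left_mono) auto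
    finally show ?thesis .
  qed
  show ?thesis
  proof (intro exI allI)
    fix y
    have "poly p y * exp (- y\<^sup>2) = (\<Sum>j\<le>degree p. coeff p j * (y ^ j * exp (- y\<^sup>2)))"
      by (simp add: poly_altdef sum_distrib_right mult.assoc)
    then have "\<bar>poly p y * exp (- y\<^sup>2)\<bar> \<le> (\<Sum>j\<le>degree p. \<bar>coeff p j\<bar> * (\<bar>y\<bar> ^ j * exp (- y\<^sup>2)))"
      by (auto intro!: order_trans[OF sum_abs] simp: abs_mult power_abs)
    also have "\<dots> \<le> (\<Sum>j\<le>degree p. \<bar>coeff p j\<bar> * (fact j * exp 1))"
      by (intro sum_mono mult_left_mono mon) auto
    finally show "\<bar>poly p y * exp (- y\<^sup>2)\<bar> \<le> (\<Sum>j\<le>degree p. \<bar>coeff p j\<bar> * (fact j * exp 1))" .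
  qed
qed

text \<open>At unit scale the estimate interpolates: far points use the sup bound, near points the
  Lipschitz bound from the next derivative. Rescaling gives s^m from the m derivatives and
  s^(\<beta> - m) from the distance, together s^\<beta>, so B does not depend on s or x0.\<close>

lemma gauss_deriv_holder:
  assumes "\<beta> > 0"
  defines "m \<equiv> nat (\<lceil>\<beta>\<rceil> - 1)"
  shows "\<exists>B>0. \<forall>s>0. \<forall>x0 x y. \<bar>gauss_deriv s x0 m x - gauss_deriv s x0 m y\<bar>
            \<le> B / s powr \<beta> * \<bar>x - y\<bar> powr (\<beta> - real m)"
proof -
  define \<alpha> where "\<alpha> = \<beta> - real m"
  have \<alpha>: "0 < \<alpha>" "\<alpha> \<le> 1" using ceiling_exponent[OF assms(1)] by (auto simp: \<alpha>_def m_def)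
  obtain B0 where B0: "\<And>y. \<bar>poly (gauss_poly m) y * exp (- y\<^sup>2)\<bar> \<le> B0"
    using gauss_poly_exp_bounded by blast
  obtain B1 where B1: "\<And>y. \<bar>poly (gauss_poly (Suc m)) y * exp (- y\<^sup>2)\<bar> \<le> B1"
    using gauss_poly_exp_bounded by blast
  \<comment> \<open>The term 2 * B0 serves points at distance at least 1, B1 the closer ones, and 1
    makes B positive.\<close>
  define B where "B = 2 * B0 + B1 + 1"
  have B0': "0 \<le> B0" and B1': "0 \<le> B1" using B0[of 0] B1[of 0] by linarith+
  define G where "G = gauss_deriv 1 0 m"
  have G0: "\<bar>G u\<bar> \<le> B0" for u using B0[of u] by (simp add: G_def gauss_deriv_def)
  have scaled: "\<bar>G u - G v\<bar> \<le> B * \<bar>u - v\<bar> powr \<alpha>" for u v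
  proof (cases "\<bar>u - v\<bar> \<ge> 1")
    case True
    have "\<bar>G u - G v\<bar> \<le> B * 1" using G0[of u] G0[of v] B1' by (simp add: B_def)
    also have "\<dots> \<le> B * \<bar>u - v\<bar> powr \<alpha>"
      using True \<alpha> B0' B1' by (intro mult_left_mono ge_one_powr_ge_zero) (auto simp: B_def)
    finally show ?thesis .
  next
    case False
    have "norm (G u - G v) \<le> B1 * norm (u - v)"
    proof (rule field_differentiable_bound[of UNIV G "gauss_deriv 1 0 (Suc m)"])
      fix z :: real
      show "(G has_real_derivative gauss_deriv 1 0 (Suc m) z) (at z within UNIV)"
        unfolding G_def by (rule gauss_deriv_has_derivative) simp
      show "norm (gauss_deriv 1 0 (Suc m) z) \<le> B1"
        using B1[of z] by (simp add: gauss_deriv_def)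
    qed auto
    then have "\<bar>G u - G v\<bar> \<le> B1 * \<bar>u - v\<bar>" by simp
    also have "\<dots> \<le> B * \<bar>u - v\<bar> powr \<alpha>"
    proof (intro mult_mono)
      show "\<bar>u - v\<bar> \<le> \<bar>u - v\<bar> powr \<alpha>"
        using False \<alpha> powr_mono'[of \<alpha> 1 "\<bar>u - v\<bar>"] by simp
    qed (use B0' B1' in \<open>auto simp: B_def\<close>)
    finally show ?thesis .
  qed
  show ?thesis
  proof (intro exI[of _ B] conjI allI impI)
    show "0 < B" using B0' B1' by (simp add: B_def)
    fix s x0 x y :: real assume s: "s > 0"
    have eq: "gauss_deriv s x0 m z = G ((z - x0) / s) / s ^ m" for z
      by (simp add: G_def gauss_deriv_def)
    have "\<bar>gauss_deriv s x0 m x - gauss_deriv s x0 m y\<bar>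
        = \<bar>G ((x - x0) / s) - G ((y - x0) / s)\<bar> / s ^ m"
      using s by (simp add: eq diff_divide_distrib[symmetric] abs_divide)
    also have "\<dots> \<le> B * \<bar>(x - x0) / s - (y - x0) / s\<bar> powr \<alpha> / s ^ m"
      using s by (intro divide_right_mono scaled) auto
    also have "\<bar>(x - x0) / s - (y - x0) / s\<bar> = \<bar>x - y\<bar> / s"
      using s by (simp add: diff_divide_distrib[symmetric] abs_divide)
    also have "B * (\<bar>x - y\<bar> / s) powr \<alpha> / s ^ m = B / (s powr \<alpha> * s powr real m) * \<bar>x - y\<bar> powr \<alpha>"
      using s by (simp add: powr_divide powr_realpow)
    also have "s powr \<alpha> * s powr real m = s powr \<beta>"
      by (simp add: powr_add[symmetric] \<alpha>_def)
    finally show "\<bar>gauss_deriv s x0 m x - gauss_deriv s x0 m y\<bar>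
            \<le> B / s powr \<beta> * \<bar>x - y\<bar> powr (\<beta> - real m)" by (simp add: \<alpha>_def)
  qed
qed

lemma has_bochner_integral_gauss:
  assumes "s > 0"
  shows "has_bochner_integral lborel (\<lambda>x::real. exp (- ((x - x0) / s)\<^sup>2)) (s * sqrt pi)"
proof -
  have "has_bochner_integral lborel (\<lambda>x::real. exp (- x\<^sup>2)) (sqrt pi)"
    using has_bochner_integral_even_function[OF gaussian_moment_0] by simp
  then have "has_bochner_integral lborel (\<lambda>x. exp (- (- x0 / s + (1 / s) * x)\<^sup>2)) (sqrt pi /\<^sub>R \<bar>1 / s\<bar>)"
    using assms by (subst (asm) lborel_has_bochner_integral_real_affine_iff[of "1/s" _ _ "- x0 / s"]) auto
  then show ?thesis
    using assms by (simp add: diff_divide_distrib mult.commute)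
qed

subsection \<open>Samples\<close>

lemma holder_densities_basic:
  assumes "f \<in> holder_densities \<beta> \<gamma>"
  shows "f \<in> borel_measurable borel" "\<And>x. 0 \<le> f x" "integrable lborel f" "integral\<^sup>L lborel f = 1"
  using assms by (auto simp: holder_densities_def Let_def has_bochner_integral_iff)

lemma integrable_mult_bounded:
  fixes f Y :: "real \<Rightarrow> real"
  assumes "\<And>x. 0 \<le> f x" "integrable lborel f" "Y \<in> borel_measurable borel" "\<And>y. \<bar>Y y\<bar> \<le> c"
  shows "integrable lborel (\<lambda>y. f y * Y y)"
proof (rule Bochner_Integration.integrable_bound)
  show "integrable lborel (\<lambda>y. f y * c)" using assms(2) by simp
  show "(\<lambda>y. f y * Y y) \<in> borel_measurable lborel" using assms(2,3) by simp
  show "AE y in lborel. norm (f y * Y y) \<le> norm (f y * c)"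
  proof (rule AE_I2)
    fix y
    have "\<bar>Y y\<bar> \<le> \<bar>c\<bar>" using assms(4)[of y] by linarith
    then show "norm (f y * Y y) \<le> norm (f y * c)"
      using assms(1)[of y] by (simp add: abs_mult mult_left_mono)
  qed
qed

lemma prob_space_density_lborel:
  fixes f :: "real \<Rightarrow> real"
  assumes "\<And>x. 0 \<le> f x" "integrable lborel f" "integral\<^sup>L lborel f = 1"
  shows "prob_space (density lborel (\<lambda>x. ennreal (f x)))"
proof
  have "(\<integral>\<^sup>+ x. ennreal (f x) \<partial>lborel) = 1"
    using nn_integral_eq_integral[OF assms(2)] assms by simp
  then show "emeasure (density lborel (\<lambda>x. ennreal (f x))) (space (density lborel (\<lambda>x. ennreal (f x)))) = 1"
    using assms(2) by (simp add: emeasure_density)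
qed

lemma sets_iid_sample: "sets (iid_sample n f) = sets (sample_space n)"
  unfolding iid_sample_def sample_space_def by (intro sets_PiM_cong) auto

lemma space_iid_sample: "space (iid_sample n f) = space (sample_space n)"
  by (rule sets_eq_imp_space_eq[OF sets_iid_sample])

lemma measurable_iid_sample: "measurable (iid_sample n f) N = measurable (sample_space n) N"
  by (rule measurable_cong_sets[OF sets_iid_sample refl])

lemma prob_space_iid_sample:
  fixes f :: "real \<Rightarrow> real"
  assumes "\<And>x. 0 \<le> f x" "integrable lborel f" "integral\<^sup>L lborel f = 1"
  shows "prob_space (iid_sample n f)"
  unfolding iid_sample_def by (intro prob_space_PiM prob_space_density_lborel assms)

section \<open>Exponential deviation bounds for sample means\<close>

lemma exp_le_quadratic:
  fixes x :: real
  assumes "\<bar>x\<bar> \<le> 1"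
  shows "exp x \<le> 1 + x + x\<^sup>2"
proof (cases "x \<ge> 0")
  case True
  then show ?thesis using exp_bound[of x] assms by simp
next
  case False
  define t where "t = - x"
  have t: "0 \<le> t" using False by (simp add: t_def)
  \<comment> \<open>With x = - t the claim reads 1 \<le> (1 - t + t^2) * exp t. Replacing exp t by
    its quadratic Taylor minorant leaves a polynomial with constant term 1 and nonnegative
    coefficients.\<close>
  have "(1 - t + t\<^sup>2) * (1 + t + t\<^sup>2 / 2) = 1 + t\<^sup>2 / 2 + t ^ 3 / 2 + t ^ 4 / 2"
    by (simp add: field_simps power2_eq_square power3_eq_cube power4_eq_xxxx)
  then have "1 \<le> (1 - t + t\<^sup>2) * (1 + t + t\<^sup>2 / 2)" using t by simp
  also have "\<dots> \<le> (1 - t + t\<^sup>2) * exp t"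
  proof (intro mult_left_mono exp_lower_Taylor_quadratic t)
    have "t \<le> 1" using assms by (simp add: t_def)
    then show "0 \<le> 1 - t + t\<^sup>2" by (simp add: add_nonneg_nonneg)
  qed
  finally show ?thesis by (simp add: t_def exp_minus field_simps)
qed

text \<open>Exponential Markov inequality: the indicator of the event is at most a product of tilted
  factors, and independence splits its integral. The quadratic bound for exp, valid because
  \<bar>\<theta> * Y y\<bar> \<le> 1, leaves only the first two moments of Y. The tilt \<theta>
  stays free, to be tuned by the caller.\<close>

lemma iid_sample_chernoff:
  fixes f Y :: "real \<Rightarrow> real"
  assumes f: "\<And>x. 0 \<le> f x" "integrable lborel f" "integral\<^sup>L lborel f = 1"
    and Y[measurable]: "Y \<in> borel_measurable borel"
    and l: "0 < \<theta>" "\<And>y. \<bar>\<theta> * Y y\<bar> \<le> 1"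
    and v: "(\<integral>y. f y * (Y y)\<^sup>2 \<partial>lborel) \<le> v"
  shows "measure (iid_sample n f)
      {x \<in> space (sample_space n). real n * \<epsilon> \<le> (\<Sum>i<n. Y (x i)) - real n * (\<integral>y. f y * Y y \<partial>lborel)}
      \<le> exp (- (real n * \<theta> * (\<epsilon> - \<theta> * v)))"
proof -
  have [measurable]: "f \<in> borel_measurable borel" using f(2) by auto
  define \<mu> where "\<mu> = (\<integral>y. f y * Y y \<partial>lborel)"
  define F where "F = density lborel (\<lambda>x. ennreal (f x))"
  interpret F: prob_space F unfolding F_def by (intro prob_space_density_lborel f)
  interpret product_sigma_finite "\<lambda>_::nat. F" by standard
  have P: "iid_sample n f = PiM {..<n} (\<lambda>_. F)" by (simp add: iid_sample_def F_def)
  interpret P: prob_space "iid_sample n f" by (intro prob_space_iid_sample f)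
  have [measurable_cong]: "sets F = sets borel" by (simp add: F_def)
  have Yb: "\<bar>Y y\<bar> \<le> 1 / \<theta>" for y
    using l(2)[of y] l(1) by (simp add: abs_mult field_simps)
  have i1: "integrable lborel (\<lambda>y. f y * Y y)"
    by (rule integrable_mult_bounded[OF f(1,2) Y Yb])
  have i2: "integrable lborel (\<lambda>y. f y * (Y y)\<^sup>2)"
  proof (rule integrable_mult_bounded[OF f(1,2), where c = "(1 / \<theta>)\<^sup>2"])
    show "\<bar>(Y y)\<^sup>2\<bar> \<le> (1 / \<theta>)\<^sup>2" for y
      using power_mono[OF Yb[of y], of 2] by simp
  qed measurable
  let ?A = "{x \<in> space (sample_space n). real n * \<epsilon> \<le> (\<Sum>i<n. Y (x i)) - real n * \<mu>}"
  let ?e = "\<lambda>y. ennreal (exp (\<theta> * (Y y - \<mu> - \<epsilon>)))"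
  have A: "?A \<in> sets (iid_sample n f)"
    unfolding sets_iid_sample unfolding sample_space_def by measurable
  have single: "(\<integral>\<^sup>+ y. ?e y \<partial>F) \<le> ennreal (exp (- (\<theta> * (\<epsilon> - \<theta> * v))))"
  proof -
    \<comment> \<open>\<open>?q\<close> is f times the quadratic majorant of exp (\<theta> * Y); the
      constant centring factor is kept outside, so integration gives the raw moments
      directly.\<close>
    let ?q = "\<lambda>y. f y + \<theta> * (f y * Y y) + \<theta>\<^sup>2 * (f y * (Y y)\<^sup>2)"
    have "(\<integral>\<^sup>+ y. ?e y \<partial>F) = (\<integral>\<^sup>+ y. ennreal (f y) * ?e y \<partial>lborel)"
      unfolding F_def by (subst nn_integral_density) auto
    also have "\<dots> \<le> (\<integral>\<^sup>+ y. ennreal (exp (- (\<theta> * (\<mu> + \<epsilon>))) * ?q y) \<partial>lborel)"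
    proof (rule nn_integral_mono)
      fix y
      have "f y * exp (\<theta> * Y y) \<le> f y * (1 + \<theta> * Y y + (\<theta> * Y y)\<^sup>2)"
        using f(1) by (intro mult_left_mono exp_le_quadratic l) auto
      then have "exp (- (\<theta> * (\<mu> + \<epsilon>))) * (f y * exp (\<theta> * Y y)) \<le> exp (- (\<theta> * (\<mu> + \<epsilon>))) * ?q y"
        by (intro mult_left_mono) (auto simp: algebra_simps power_mult_distrib)
      moreover have "exp (- (\<theta> * (\<mu> + \<epsilon>))) * (f y * exp (\<theta> * Y y)) = f y * exp (\<theta> * (Y y - \<mu> - \<epsilon>))"
      proof -
        have "exp (\<theta> * (Y y - \<mu> - \<epsilon>)) = exp (- (\<theta> * (\<mu> + \<epsilon>))) * exp (\<theta> * Y y)"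
          unfolding exp_add[symmetric] by (simp add: algebra_simps)
        then show ?thesis by simp
      qed
      ultimately show "ennreal (f y) * ?e y \<le> ennreal (exp (- (\<theta> * (\<mu> + \<epsilon>))) * ?q y)"
        using f(1) by (auto simp: ennreal_mult[symmetric] intro!: ennreal_leI)
    qed
    also have "\<dots> = ennreal (\<integral> y. exp (- (\<theta> * (\<mu> + \<epsilon>))) * ?q y \<partial>lborel)"
    proof (rule nn_integral_eq_integral)
      show "integrable lborel (\<lambda>y. exp (- (\<theta> * (\<mu> + \<epsilon>))) * ?q y)"
        using f(2) i1 i2 by simp
      show "AE y in lborel. 0 \<le> exp (- (\<theta> * (\<mu> + \<epsilon>))) * ?q y"
      proof (rule AE_I2)
        fix y
        have "0 \<le> f y * (1 + \<theta> * Y y + (\<theta> * Y y)\<^sup>2)"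
          using f(1)[of y] exp_le_quadratic[OF l(2)[of y]] exp_gt_zero[of "\<theta> * Y y"]
          by (intro mult_nonneg_nonneg) linarith+
        also have "f y * (1 + \<theta> * Y y + (\<theta> * Y y)\<^sup>2) = ?q y"
          by (simp add: algebra_simps power_mult_distrib)
        finally show "0 \<le> exp (- (\<theta> * (\<mu> + \<epsilon>))) * ?q y" by (intro mult_nonneg_nonneg) auto
      qed
    qed
    also have "(\<integral> y. exp (- (\<theta> * (\<mu> + \<epsilon>))) * ?q y \<partial>lborel)
        = exp (- (\<theta> * (\<mu> + \<epsilon>))) * (1 + \<theta> * \<mu> + \<theta>\<^sup>2 * (\<integral>y. f y * (Y y)\<^sup>2 \<partial>lborel))"
      using f i1 i2 by (simp add: \<mu>_def)
    \<comment> \<open>By 1 + z \<le> exp z the moment polynomial becomes an exponential again, whose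
      \<theta> * \<mu> cancels against the centring factor.\<close>
    also have "\<dots> \<le> exp (- (\<theta> * (\<mu> + \<epsilon>))) * exp (\<theta> * \<mu> + \<theta>\<^sup>2 * v)"
    proof (intro mult_left_mono)
      have "1 + \<theta> * \<mu> + \<theta>\<^sup>2 * (\<integral>y. f y * (Y y)\<^sup>2 \<partial>lborel) \<le> 1 + (\<theta> * \<mu> + \<theta>\<^sup>2 * v)"
        using mult_left_mono[OF v, of "\<theta>\<^sup>2"] by simp
      also have "\<dots> \<le> exp (\<theta> * \<mu> + \<theta>\<^sup>2 * v)" by (rule exp_ge_add_one_self)
      finally show "1 + \<theta> * \<mu> + \<theta>\<^sup>2 * (\<integral>y. f y * (Y y)\<^sup>2 \<partial>lborel) \<le> exp (\<theta> * \<mu> + \<theta>\<^sup>2 * v)" .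
    qed simp
    also have "\<dots> = exp (- (\<theta> * (\<epsilon> - \<theta> * v)))"
      unfolding exp_add[symmetric] by (simp add: algebra_simps power2_eq_square)
    finally show ?thesis by (simp add: ennreal_leI)
  qed
  have "emeasure (iid_sample n f) ?A = (\<integral>\<^sup>+ x. indicator ?A x \<partial>iid_sample n f)"
    using A by simp
  also have "\<dots> \<le> (\<integral>\<^sup>+ x. (\<Prod>i<n. ?e (x i)) \<partial>iid_sample n f)"
  proof (rule nn_integral_mono)
    fix x
    have "indicator ?A x \<le> ennreal (exp (\<theta> * ((\<Sum>i<n. Y (x i)) - real n * \<mu> - real n * \<epsilon>)))"
    proof (cases "x \<in> ?A")
      case True
      then have "0 \<le> \<theta> * ((\<Sum>i<n. Y (x i)) - real n * \<mu> - real n * \<epsilon>)"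
        using l(1) by (intro mult_nonneg_nonneg) auto
      then show ?thesis using True by (simp add: ennreal_leI[of 1, simplified])
    qed simp
    also have "exp (\<theta> * ((\<Sum>i<n. Y (x i)) - real n * \<mu> - real n * \<epsilon>)) = (\<Prod>i<n. exp (\<theta> * (Y (x i) - \<mu> - \<epsilon>)))"
    proof -
      have "\<theta> * ((\<Sum>i<n. Y (x i)) - real n * \<mu> - real n * \<epsilon>) = (\<Sum>i<n. \<theta> * (Y (x i) - \<mu> - \<epsilon>))"
        by (simp add: sum_distrib_left[symmetric] sum_subtractf)
      then show ?thesis by (simp only: exp_sum finite_lessThan)
    qed
    also have "ennreal (\<Prod>i<n. exp (\<theta> * (Y (x i) - \<mu> - \<epsilon>))) = (\<Prod>i<n. ?e (x i))"
      by (rule prod_ennreal[symmetric]) auto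
    finally show "indicator ?A x \<le> (\<Prod>i<n. ?e (x i))" .
  qed
  also have "\<dots> = (\<Prod>i<n. \<integral>\<^sup>+ y. ?e y \<partial>F)"
    unfolding P by (rule product_nn_integral_prod) auto
  also have "\<dots> \<le> (\<Prod>i<n. ennreal (exp (- (\<theta> * (\<epsilon> - \<theta> * v)))))"
    by (intro prod_mono_ennreal single)
  also have "\<dots> = ennreal (exp (- (real n * \<theta> * (\<epsilon> - \<theta> * v))))"
  proof -
    have "real n * - (\<theta> * (\<epsilon> - \<theta> * v)) = - (real n * \<theta> * (\<epsilon> - \<theta> * v))" by simp
    then have "exp (- (\<theta> * (\<epsilon> - \<theta> * v))) ^ n = exp (- (real n * \<theta> * (\<epsilon> - \<theta> * v)))"
      by (metis exp_of_nat_mult)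
    then show ?thesis by (simp add: ennreal_power)
  qed
  finally show ?thesis
    unfolding \<mu>_def by (simp add: P.emeasure_eq_measure)
qed

text \<open>The one-sided bound is applied to Y and to - Y, which share the second moment; the union
  bound accounts for the factor 2.\<close>

lemma iid_sample_mean_deviation:
  fixes f Y :: "real \<Rightarrow> real"
  assumes f: "\<And>x. 0 \<le> f x" "integrable lborel f" "integral\<^sup>L lborel f = 1"
    and Y[measurable]: "Y \<in> borel_measurable borel"
    and l: "0 < \<theta>" "\<And>y. \<bar>\<theta> * Y y\<bar> \<le> 1"
    and v: "(\<integral>y. f y * (Y y)\<^sup>2 \<partial>lborel) \<le> v"
    and n: "1 \<le> n"
  shows "1 - 2 * exp (- (real n * \<theta> * (\<epsilon> - \<theta> * v))) \<le> measure (iid_sample n f)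
      {x \<in> space (sample_space n). \<bar>(\<Sum>i<n. Y (x i)) / real n - (\<integral>y. f y * Y y \<partial>lborel)\<bar> \<le> \<epsilon>}"
    (is "_ \<le> measure _ ?G")
proof -
  define \<mu> where "\<mu> = (\<integral>y. f y * Y y \<partial>lborel)"
  interpret P: prob_space "iid_sample n f" by (intro prob_space_iid_sample f)
  let ?A = "{x \<in> space (sample_space n). real n * \<epsilon> \<le> (\<Sum>i<n. Y (x i)) - real n * \<mu>}"
  let ?B = "{x \<in> space (sample_space n). real n * \<epsilon> \<le> (\<Sum>i<n. - Y (x i)) - real n * (- \<mu>)}"
  have A: "?A \<in> sets (iid_sample n f)" and B: "?B \<in> sets (iid_sample n f)"
    and G: "?G \<in> sets (iid_sample n f)"
    unfolding sets_iid_sample \<mu>_def[symmetric] unfolding sample_space_def by measurable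
  have mA: "measure (iid_sample n f) ?A \<le> exp (- (real n * \<theta> * (\<epsilon> - \<theta> * v)))"
    unfolding \<mu>_def by (rule iid_sample_chernoff) fact+
  have mB: "measure (iid_sample n f) ?B \<le> exp (- (real n * \<theta> * (\<epsilon> - \<theta> * v)))"
    using iid_sample_chernoff[of f "\<lambda>y. - Y y" \<theta> v n \<epsilon>] f l v by (simp add: \<mu>_def)
  have "space (iid_sample n f) \<subseteq> ?G \<union> (?A \<union> ?B)"
  proof
    fix x assume x: "x \<in> space (iid_sample n f)"
    define a where "a = (\<Sum>i<n. Y (x i)) / real n - \<mu>"
    have S: "(\<Sum>i<n. Y (x i)) - real n * \<mu> = real n * a"
      using n by (simp add: a_def right_diff_distrib)
    consider "\<bar>a\<bar> \<le> \<epsilon>" | "\<epsilon> \<le> a" | "\<epsilon> \<le> - a" by linarith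
    then show "x \<in> ?G \<union> (?A \<union> ?B)"
    proof cases
      case 1
      then show ?thesis using x by (simp add: a_def \<mu>_def space_iid_sample)
    next
      case 2
      then have "real n * \<epsilon> \<le> real n * a" by (intro mult_left_mono) auto
      then show ?thesis using x by (simp add: S space_iid_sample)
    next
      case 3
      then have "real n * \<epsilon> \<le> real n * (- a)" by (intro mult_left_mono) auto
      then show ?thesis using x S by (simp add: sum_negf space_iid_sample)
    qed
  qed
  then have "1 \<le> measure (iid_sample n f) (?G \<union> (?A \<union> ?B))"
    using P.finite_measure_mono[of "space (iid_sample n f)" "?G \<union> (?A \<union> ?B)"] A B G P.prob_space
    by (simp add: sets.Un)
  also have "\<dots> \<le> measure (iid_sample n f) ?G + (measure (iid_sample n f) ?A + measure (iid_sample n f) ?B)"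
    using measure_Un_le[OF G sets.Un[OF A B]] measure_Un_le[OF A B]
    by linarith
  finally show ?thesis using mA mB by simp
qed

subsection \<open>Discretised estimators\<close>

text \<open>Converts a real statistic into an estimator with values in the class, as the definition
  of the minimax quantile demands. Rounding to a grid of mesh \<epsilon> replaces a measurable
  selection by countably many choices.\<close>

lemma minimax_quantile_le_of_real_estimator:
  assumes T[measurable]: "T \<in> borel_measurable (sample_space n)"
    and \<epsilon>: "0 < \<epsilon>" and \<Theta>: "\<Theta> \<noteq> {}"
    and meas: "\<And>f. f \<in> \<Theta> \<Longrightarrow> prob_space (iid_sample n f)"
    and good: "\<And>f. f \<in> \<Theta> \<Longrightarrow>
      1 - \<delta> \<le> measure (iid_sample n f) {x \<in> space (sample_space n). \<bar>T x - f x0\<bar> \<le> \<epsilon>}"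
  shows "minimax_quantile \<delta> (sample_space n) \<Theta>
            (\<lambda>f1 f2. \<bar>f1 x0 - f2 x0\<bar>) (\<lambda>f. {iid_sample n f})
            (\<lambda>f1 f2. (f1 x0 - f2 x0)\<^sup>2) \<le> ennreal ((4 * \<epsilon>)\<^sup>2)"
proof -
  \<comment> \<open>The radius 2 * \<epsilon> allows one \<epsilon> for the error of T and one for
    rounding. The true density and the selected one are both that close to the grid point, hence the
    final 4 * \<epsilon>.\<close>
  define near where "near k f \<longleftrightarrow> f \<in> \<Theta> \<and> \<bar>f x0 - of_int k * \<epsilon>\<bar> \<le> 2 * \<epsilon>" for k :: int and f
  \<comment> \<open>The fallback member keeps g inside \<Theta> for cells that no density is near.
    Whenever T is within \<epsilon> of f x0, f itself is near the cell, so the first branch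
    applies.\<close>
  define g where "g k = (if \<exists>f. near k f then SOME f. near k f else SOME f. f \<in> \<Theta>)" for k
  have near: "near k (g k)" if "near k f" for k f
    using someI[of "near k", OF that] that by (auto simp: g_def)
  have g: "g k \<in> \<Theta>" for k
  proof (cases "\<exists>f. near k f")
    case True
    then show ?thesis using near by (auto simp: near_def)
  next
    case False
    then show ?thesis using \<Theta> by (simp add: g_def some_in_eq)
  qed
  define est where "est x = g \<lfloor>T x / \<epsilon>\<rfloor>" for x
  have fl: "(\<lambda>x. \<lfloor>T x / \<epsilon>\<rfloor>) \<in> measurable (sample_space n) (count_space UNIV)"
    by measurable
  \<comment> \<open>Out of \<open>count_space UNIV\<close> every map into the target space is
    measurable, so it suffices to identify that space.\<close>
  have "space (pseudometric_borel \<Theta> (\<lambda>f1 f2. \<bar>f1 x0 - f2 x0\<bar>)) = \<Theta>"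
    unfolding pseudometric_borel_def
    by (rule space_measure_of) (auto simp: openin_pseudometric_topology)
  then have est: "est \<in> measurable (sample_space n) (pseudometric_borel \<Theta> (\<lambda>f1 f2. \<bar>f1 x0 - f2 x0\<bar>))"
    unfolding est_def by (intro measurable_compose[OF fl]) (auto simp: g)
  have estx: "(\<lambda>x. est x x0) \<in> borel_measurable (sample_space n)"
    unfolding est_def by (rule measurable_compose[OF fl]) simp
  have "quantile \<delta> P (\<lambda>x. (est x x0 - f x0)\<^sup>2) \<le> ennreal ((4 * \<epsilon>)\<^sup>2)"
    if f: "f \<in> \<Theta>" and P: "P \<in> {iid_sample n f}" for f P
  proof -
    interpret prob_space P using meas f P by simp
    have "{x \<in> space (sample_space n). \<bar>T x - f x0\<bar> \<le> \<epsilon>} \<subseteq>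
        {x \<in> space P. (est x x0 - f x0)\<^sup>2 \<le> (4 * \<epsilon>)\<^sup>2}"
    proof safe
      fix x assume x: "x \<in> space (sample_space n)" and le: "\<bar>T x - f x0\<bar> \<le> \<epsilon>"
      show "x \<in> space P" using x P by (simp add: space_iid_sample)
      define k where "k = \<lfloor>T x / \<epsilon>\<rfloor>"
      have "of_int k \<le> T x / \<epsilon>" "T x / \<epsilon> \<le> of_int k + 1"
        unfolding k_def by linarith+
      then have "of_int k * \<epsilon> \<le> T x" "T x \<le> of_int k * \<epsilon> + \<epsilon>"
        using \<epsilon> by (auto simp: field_simps)
      then have "\<bar>f x0 - of_int k * \<epsilon>\<bar> \<le> 2 * \<epsilon>" using le by linarith
      then have "near k (g k)" "near k f" using near f by (auto simp: near_def)
      then have "\<bar>est x x0 - f x0\<bar> \<le> 4 * \<epsilon>"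
        unfolding est_def k_def[symmetric] near_def by linarith
      then show "(est x x0 - f x0)\<^sup>2 \<le> (4 * \<epsilon>)\<^sup>2"
        using \<epsilon> by (intro power2_le_iff_abs_le[THEN iffD2]) auto
    qed
    moreover have "{x \<in> space P. (est x x0 - f x0)\<^sup>2 \<le> (4 * \<epsilon>)\<^sup>2} \<in> sets P"
    proof -
      have [measurable]: "(\<lambda>x. est x x0) \<in> borel_measurable P"
        using estx P by (simp add: measurable_iid_sample)
      show ?thesis by measurable
    qed
    ultimately have "measure P {x \<in> space (sample_space n). \<bar>T x - f x0\<bar> \<le> \<epsilon>}
        \<le> measure P {x \<in> space P. (est x x0 - f x0)\<^sup>2 \<le> (4 * \<epsilon>)\<^sup>2}"
      by (rule finite_measure_mono)
    then have "1 - \<delta> \<le> measure P {x \<in> space P. (est x x0 - f x0)\<^sup>2 \<le> (4 * \<epsilon>)\<^sup>2}"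
      using good[OF f] P by simp
    then show ?thesis
      unfolding quantile_def by (intro Inf_lower imageI) auto
  qed
  then show ?thesis
    unfolding minimax_quantile_def
    by (intro INF_lower2[OF est] SUP_least) auto
qed

subsection \<open>Kernel estimation\<close>

text \<open>The substitution y = x0 + j * t turns the average of c j * f (x0 + j * t) over t in (0,
  h] into c j / (j * h) times the integral of f over (x0, x0 + j * h]. The kernel collects these
  weights and is one-sided.\<close>

definition step_kernel :: "(nat \<Rightarrow> real) \<Rightarrow> nat \<Rightarrow> real \<Rightarrow> real \<Rightarrow> real \<Rightarrow> real" where
  "step_kernel c N h x0 y = (\<Sum>j=1..N. c j / (real j * h) * indicator {x0<..x0 + real j * h} y)"

lemma borel_measurable_step_kernel [measurable]: "step_kernel c N h x0 \<in> borel_measurable borel"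
  unfolding step_kernel_def[abs_def] by measurable

lemma abs_step_kernel_le:
  assumes "h > 0"
  shows "\<bar>step_kernel c N h x0 y\<bar> \<le> (\<Sum>j=1..N. \<bar>c j\<bar>) / h"
proof -
  have "\<bar>c j / (real j * h) * indicator {x0<..x0 + real j * h} y\<bar> \<le> \<bar>c j\<bar> / h"
    if "j \<in> {1..N}" for j
  proof -
    have "1 * h \<le> real j * h" using that assms by (intro mult_right_mono) auto
    then have "\<bar>c j\<bar> / (real j * h) \<le> \<bar>c j\<bar> / h"
      using assms that by (intro divide_left_mono) auto
    then show ?thesis using assms by (auto simp: abs_mult abs_divide split: split_indicator)
  qed
  then show ?thesis
    unfolding step_kernel_def sum_divide_distrib by (intro order_trans[OF sum_abs] sum_mono)
qed

lemma integrable_indicator_Ioc [simp]: "integrable lborel (indicator {a<..b} :: real \<Rightarrow> real)"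
  by (cases "a \<le> b") (auto intro!: integrable_real_indicator)

lemma step_kernel_eq_0:
  assumes "h > 0" "y \<notin> {x0<..x0 + real N * h}"
  shows "step_kernel c N h x0 y = 0"
  unfolding step_kernel_def
proof (intro sum.neutral ballI)
  fix j assume "j \<in> {1..N}"
  then have "real j * h \<le> real N * h" using assms(1) by (intro mult_right_mono) auto
  then show "c j / (real j * h) * indicator {x0<..x0 + real j * h} y = 0"
    using assms(2) by (auto split: split_indicator)
qed

text \<open>The bias bound comes from averaging the finite difference over the step \<open>t \<in> (0, h]\<close>.\<close>

lemma step_kernel_bias:
  assumes "\<beta> > 0"
  shows "\<exists>c N. \<forall>\<gamma> f h x0. f \<in> holder_densities \<beta> \<gamma> \<longrightarrow> h > 0 \<longrightarrow> \<gamma> \<ge> 0 \<longrightarrow>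
     \<bar>f x0 - (\<integral>y. f y * step_kernel c N h x0 y \<partial>lborel)\<bar> \<le> \<gamma> * h powr \<beta>"
proof -
  define N where "N = Suc (nat (\<lceil>\<beta>\<rceil> - 1))"
  obtain c :: "nat \<Rightarrow> real" where c: "\<And>\<gamma> f t x. f \<in> holder_densities \<beta> \<gamma> \<Longrightarrow> t > 0 \<Longrightarrow>
     \<bar>f x - (\<Sum>j=1..N. c j * f (x + real j * t))\<bar> \<le> \<gamma> * t powr \<beta>"
    using holder_finite_difference[OF assms] unfolding N_def by blast
  show ?thesis
  proof (intro exI[of _ c] exI[of _ N] allI impI)
    fix \<gamma> h x0 :: real and f assume f: "f \<in> holder_densities \<beta> \<gamma>" and h: "h > 0" and \<gamma>: "\<gamma> \<ge> 0"
    note f_basic = holder_densities_basic[OF f]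
    note [measurable] = f_basic(1)
    let ?I = "\<lambda>j y. indicator {x0<..x0 + real j * h} y * f y :: real"
    let ?J = "\<lambda>t. indicator {0<..h} t :: real"
    have intI: "integrable lborel (?I j)" for j
      using integrable_mult_bounded[OF f_basic(2,3), of "indicator {x0<..x0 + real j * h}" 1]
      by (simp add: mult.commute)
    \<comment> \<open>The affine map t \<mapsto> x0 + j * t carries (0, h] to the support of the
      j-th kernel term.\<close>
    have shift: "?I j (x0 + real j * t) = ?J t * f (x0 + real j * t)" if "j \<in> {1..N}" for j t
      using that h by (auto split: split_indicator simp: zero_less_mult_iff)
    have intJ: "integrable lborel (\<lambda>t. ?J t * f (x0 + real j * t))" if j: "j \<in> {1..N}" for j
      using lborel_integrable_real_affine[OF intI[of j], of "real j" x0] j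
      by (simp only: shift[OF j]) simp
    have aff: "(\<integral>y. ?I j y \<partial>lborel) = real j * (\<integral>t. ?J t * f (x0 + real j * t) \<partial>lborel)"
      if j: "j \<in> {1..N}" for j
      using lborel_integral_real_affine[of "real j" "?I j" x0] j
      by (simp only: shift[OF j]) simp
    have intJ1: "integrable lborel ?J" by simp
    have J1: "(\<integral>t. ?J t \<partial>lborel) = h" using h by simp
    have "(\<integral>y. f y * step_kernel c N h x0 y \<partial>lborel)
        = (\<integral>y. (\<Sum>j=1..N. c j / (real j * h) * ?I j y) \<partial>lborel)"
      by (simp add: step_kernel_def sum_distrib_left mult_ac)
    also have "\<dots> = (\<Sum>j=1..N. c j / (real j * h) * (\<integral>y. ?I j y \<partial>lborel))"
      using intI by (subst Bochner_Integration.integral_sum) auto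
    also have "\<dots> = (\<Sum>j=1..N. c j / h * (\<integral>t. ?J t * f (x0 + real j * t) \<partial>lborel))"
      using h by (intro sum.cong refl) (simp add: aff)
    finally have K: "h * (\<integral>y. f y * step_kernel c N h x0 y \<partial>lborel)
        = (\<Sum>j=1..N. c j * (\<integral>t. ?J t * f (x0 + real j * t) \<partial>lborel))"
      using h by (simp add: sum_distrib_left)
    \<comment> \<open>\<open>?D\<close> is the finite difference with step t, cut off to (0, h]; its
      integral is h times the bias, and the pointwise bound \<gamma> * t^\<beta> is largest at t =
      h.\<close>
    let ?D = "\<lambda>t. ?J t * f x0 - (\<Sum>j=1..N. c j * (?J t * f (x0 + real j * t)))"
    have intS: "integrable lborel (\<lambda>t. \<Sum>j=1..N. c j * (?J t * f (x0 + real j * t)))"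
      by (intro Bochner_Integration.integrable_sum integrable_mult_right intJ)
    have intJf: "integrable lborel (\<lambda>t. ?J t * f x0)"
      by (intro integrable_mult_left intJ1)
    note intD = Bochner_Integration.integrable_diff[OF intJf intS]
    have "(\<integral>t. ?D t \<partial>lborel) = h * f x0
        - (\<Sum>j=1..N. c j * (\<integral>t. ?J t * f (x0 + real j * t) \<partial>lborel))"
      unfolding Bochner_Integration.integral_diff[OF intJf intS]
      by (subst Bochner_Integration.integral_sum) (use intJ J1 in simp_all)
    then have hD: "(\<integral>t. ?D t \<partial>lborel) = h * (f x0 - (\<integral>y. f y * step_kernel c N h x0 y \<partial>lborel))"
      by (simp only: right_diff_distrib K)
    have "h * \<bar>f x0 - (\<integral>y. f y * step_kernel c N h x0 y \<partial>lborel)\<bar> = \<bar>\<integral>t. ?D t \<partial>lborel\<bar>"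
      unfolding hD abs_mult using h by simp
    also have "\<dots> \<le> (\<integral>t. \<bar>?D t\<bar> \<partial>lborel)" by (rule integral_abs_bound)
    also have "\<dots> \<le> (\<integral>t. ?J t * (\<gamma> * h powr \<beta>) \<partial>lborel)"
    proof (rule integral_mono)
      fix t
      have D_eq: "?D t = ?J t * (f x0 - (\<Sum>j=1..N. c j * f (x0 + real j * t)))"
        by (simp split: split_indicator)
      show "\<bar>?D t\<bar> \<le> ?J t * (\<gamma> * h powr \<beta>)"
      proof (cases "t \<in> {0<..h}")
        case True
        then have "\<bar>?D t\<bar> \<le> \<gamma> * t powr \<beta>" unfolding D_eq using c[OF f, of t x0] by simp
        also have "\<dots> \<le> \<gamma> * h powr \<beta>"
          using True assms \<gamma> by (intro mult_left_mono powr_mono2) auto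
        finally show ?thesis using True by simp
      qed (simp add: D_eq)
    next
      show "integrable lborel (\<lambda>t. \<bar>?D t\<bar>)" by (rule integrable_abs[OF intD])
      show "integrable lborel (\<lambda>t. ?J t * (\<gamma> * h powr \<beta>))" by (intro integrable_mult_left intJ1)
    qed
    also have "\<dots> = h * (\<gamma> * h powr \<beta>)" using J1 by simp
    finally show "\<bar>f x0 - (\<integral>y. f y * step_kernel c N h x0 y \<partial>lborel)\<bar> \<le> \<gamma> * h powr \<beta>"
      using h by simp
  qed
qed

section \<open>Size of the densities and moments of the kernel at the natural scale\<close>

lemma integral_mult_le:
  fixes f Y :: "real \<Rightarrow> real"
  assumes f: "\<And>x. 0 \<le> f x" "integrable lborel f" "integral\<^sup>L lborel f = 1"
    and Y: "Y \<in> borel_measurable borel" "\<And>y. \<bar>Y y\<bar> \<le> c"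
  shows "(\<integral>y. f y * Y y \<partial>lborel) \<le> c"
proof -
  have "(\<integral>y. f y * Y y \<partial>lborel) \<le> (\<integral>y. f y * c \<partial>lborel)"
  proof (rule integral_mono)
    show "f y * Y y \<le> f y * c" for y
      using f(1)[of y] Y(2)[of y] by (intro mult_left_mono) auto
  qed (use f(2) integrable_mult_bounded[OF f(1,2) Y] in auto)
  then show ?thesis using f(3) by simp
qed

text \<open>\<open>\<sigma>\<close> is the natural length scale of the class, \<open>h\<close> the bandwidth balancing bias and
  deviation, and \<open>w / \<sigma>\<close> the resulting error at \<open>x0\<close>.\<close>

lemma bandwidth_identities:
  fixes \<beta> \<gamma> u :: real
  assumes "\<beta> > 0" "\<gamma> > 0" "0 < u"
  defines "\<sigma> \<equiv> \<gamma> powr (- (1 / (\<beta> + 1)))"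
    and "w \<equiv> u powr (\<beta> / (2 * \<beta> + 1))"
  defines "h \<equiv> \<sigma> * u powr (1 / (2 * \<beta> + 1))"
  shows "\<gamma> powr (1 / (\<beta> + 1)) = 1 / \<sigma>" "\<gamma> powr (2 / (\<beta> + 1)) = (1 / \<sigma>)\<^sup>2"
    "\<sigma> powr (\<beta> + 1) = 1 / \<gamma>" "h powr \<beta> = \<sigma> powr \<beta> * w" "\<gamma> * h powr \<beta> = w / \<sigma>"
    "w\<^sup>2 = u powr (2 * \<beta> / (2 * \<beta> + 1))" "h * w\<^sup>2 = \<sigma> * u"
proof -
  have \<sigma>: "\<sigma> > 0" using assms(2) by (simp add: \<sigma>_def)
  show inv: "\<gamma> powr (1 / (\<beta> + 1)) = 1 / \<sigma>" by (simp add: \<sigma>_def powr_minus_divide)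
  show "\<gamma> powr (2 / (\<beta> + 1)) = (1 / \<sigma>)\<^sup>2"
    unfolding inv[symmetric] by (simp add: power2_eq_square powr_add[symmetric] add_divide_distrib[symmetric])
  have "- (1 / (\<beta> + 1)) * (\<beta> + 1) = - 1" using assms(1) by (simp add: field_simps)
  then show \<gamma>\<sigma>: "\<sigma> powr (\<beta> + 1) = 1 / \<gamma>"
    unfolding \<sigma>_def powr_powr using assms(2) by (simp add: powr_minus_divide)
  show h: "h powr \<beta> = \<sigma> powr \<beta> * w"
    using \<sigma> assms(3) by (simp add: h_def w_def powr_mult powr_powr)
  have "\<gamma> * \<sigma> powr \<beta> * \<sigma> = \<gamma> * \<sigma> powr (\<beta> + 1)" using \<sigma> by (simp add: powr_add)
  also have "\<dots> = 1" unfolding \<gamma>\<sigma> using assms(2) by simp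
  finally have "\<gamma> * \<sigma> powr \<beta> * \<sigma> = 1" .
  then show "\<gamma> * h powr \<beta> = w / \<sigma>" using \<sigma> unfolding h by (simp add: eq_divide_eq mult_ac)
  show w2: "w\<^sup>2 = u powr (2 * \<beta> / (2 * \<beta> + 1))"
    by (simp add: w_def power2_eq_square powr_add[symmetric] add_divide_distrib[symmetric])
  have "1 / (2 * \<beta> + 1) + 2 * \<beta> / (2 * \<beta> + 1) = 1"
    using assms(1) by (simp add: add_divide_distrib[symmetric])
  then have "u powr (1 / (2 * \<beta> + 1)) * u powr (2 * \<beta> / (2 * \<beta> + 1)) = u"
    using assms(3) by (simp add: powr_add[symmetric])
  then show "h * w\<^sup>2 = \<sigma> * u" by (simp add: h_def w2 mult.assoc)
qed

text \<open>A density value is at most a kernel average plus the bias. The average is at most C / h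
  because f has total mass one, and the bias is at most \<gamma> * h^\<beta>.\<close>

lemma holder_densities_le:
  assumes "\<beta> > 0"
  shows "\<exists>B>0. \<forall>\<gamma> f x. \<gamma> > 0 \<longrightarrow> f \<in> holder_densities \<beta> \<gamma> \<longrightarrow> f x \<le> B * \<gamma> powr (1 / (\<beta> + 1))"
proof -
  obtain c N where bias: "\<And>\<gamma> f h x0. f \<in> holder_densities \<beta> \<gamma> \<Longrightarrow> h > 0 \<Longrightarrow> \<gamma> \<ge> 0 \<Longrightarrow>
     \<bar>f x0 - (\<integral>y. f y * step_kernel c N h x0 y \<partial>lborel)\<bar> \<le> \<gamma> * h powr \<beta>"
    using step_kernel_bias[OF assms] by blast
  define C where "C = (\<Sum>j=1..N. \<bar>c j\<bar>)"
  have C: "C \<ge> 0" by (simp add: C_def sum_nonneg)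
  show ?thesis
  proof (intro exI[of _ "C + 1"] conjI allI impI)
    show "0 < C + 1" using C by simp
    fix \<gamma> x :: real and f assume \<gamma>: "\<gamma> > 0" and f: "f \<in> holder_densities \<beta> \<gamma>"
    \<comment> \<open>At this h the quantities 1 / h and \<gamma> * h^\<beta> coincide; it is the
      bandwidth of \<open>bandwidth_identities\<close> for u = 1.\<close>
    define h where "h = \<gamma> powr (- (1 / (\<beta> + 1)))"
    have h: "h > 0" using \<gamma> by (simp add: h_def)
    have inv: "1 / h = \<gamma> powr (1 / (\<beta> + 1))" and b: "\<gamma> * h powr \<beta> = \<gamma> powr (1 / (\<beta> + 1))"
      using bandwidth_identities(1,5)[OF assms \<gamma>, of 1] by (simp_all add: h_def)
    have "(\<integral>y. f y * step_kernel c N h x y \<partial>lborel) \<le> C / h"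
      unfolding C_def using holder_densities_basic[OF f]
      by (intro integral_mult_le abs_step_kernel_le[OF h]) auto
    then have "f x \<le> C * (1 / h) + \<gamma> * h powr \<beta>"
      using bias[OF f h, of x] \<gamma> by simp
    then show "f x \<le> (C + 1) * \<gamma> powr (1 / (\<beta> + 1))"
      unfolding inv b by (simp add: algebra_simps)
  qed
qed

text \<open>The kernel is bounded by a multiple of 1 / h and supported on an interval of length N *
  h, where f is at most F. This gives order F / h instead of the 1 / h^2 of the plain sup
  bound.\<close>

lemma step_kernel_second_moment:
  fixes f :: "real \<Rightarrow> real"
  assumes f: "\<And>x. 0 \<le> f x" "integrable lborel f" "\<And>x. f x \<le> F" and h: "h > 0"
  shows "(\<integral>y. f y * (step_kernel c N h x0 y)\<^sup>2 \<partial>lborel) \<le> F * (\<Sum>j=1..N. \<bar>c j\<bar>)\<^sup>2 * real N / h"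
proof -
  define C where "C = (\<Sum>j=1..N. \<bar>c j\<bar>)"
  let ?J = "\<lambda>y. indicator {x0<..x0 + real N * h} y :: real"
  have le: "(step_kernel c N h x0 y)\<^sup>2 \<le> (C / h)\<^sup>2" for y
    using power_mono[OF abs_step_kernel_le[OF h, of c N x0 y], of 2] by (simp add: C_def)
  have F: "0 \<le> F" using f(1)[of 0] f(3)[of 0] by linarith
  have "(\<integral>y. f y * (step_kernel c N h x0 y)\<^sup>2 \<partial>lborel) \<le> (\<integral>y. ?J y * (F * (C / h)\<^sup>2) \<partial>lborel)"
  proof (rule integral_mono)
    show "integrable lborel (\<lambda>y. f y * (step_kernel c N h x0 y)\<^sup>2)"
      using le by (intro integrable_mult_bounded[OF f(1,2), where c = "(C / h)\<^sup>2"]) auto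
    show "integrable lborel (\<lambda>y. ?J y * (F * (C / h)\<^sup>2))" by simp
    show "f y * (step_kernel c N h x0 y)\<^sup>2 \<le> ?J y * (F * (C / h)\<^sup>2)" for y
    proof (cases "y \<in> {x0<..x0 + real N * h}")
      case True
      then show ?thesis using mult_mono[OF f(3) le F] by simp
    next
      case False
      then show ?thesis using step_kernel_eq_0[OF h False] by simp
    qed
  qed
  also have "\<dots> = real N * h * (F * (C / h)\<^sup>2)" using h by simp
  also have "\<dots> = F * C\<^sup>2 * real N / h"
    using h by (simp add: power2_eq_square field_simps)
  finally show ?thesis by (simp add: C_def)
qed

text \<open>The kernel average estimates f x0 with bias at most w / \<sigma> and random error at
  most E * w / \<sigma>, the latter outside an event of probability at most 2 * \<delta>^2. The
  square of w / \<sigma> is the claimed rate.\<close>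

lemma minimax_quantile_upper_kernel:
  assumes "\<beta> > 0"
  shows "\<exists>C>0. \<forall>\<gamma> n \<delta> x0. 0 < \<gamma> \<longrightarrow> 1 \<le> n \<longrightarrow> 0 < \<delta> \<longrightarrow> \<delta> \<le> 1 / 4 \<longrightarrow> ln (1 / \<delta>) \<le> real n \<longrightarrow>
     holder_densities \<beta> \<gamma> \<noteq> {} \<longrightarrow>
     minimax_quantile \<delta> (sample_space n) (holder_densities \<beta> \<gamma>)
                 (\<lambda>f1 f2. \<bar>f1 x0 - f2 x0\<bar>) (\<lambda>f. {iid_sample n f})
                 (\<lambda>f1 f2. (f1 x0 - f2 x0)\<^sup>2)
     \<le> ennreal (C * (\<gamma> powr (2 / (\<beta> + 1)) * (ln (1 / \<delta>) / real n) powr (2 * \<beta> / (2 * \<beta> + 1))))"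
proof -
  obtain c N where bias: "\<And>\<gamma> f h x0. f \<in> holder_densities \<beta> \<gamma> \<Longrightarrow> h > 0 \<Longrightarrow> \<gamma> \<ge> 0 \<Longrightarrow>
     \<bar>f x0 - (\<integral>y. f y * step_kernel c N h x0 y \<partial>lborel)\<bar> \<le> \<gamma> * h powr \<beta>"
    using step_kernel_bias[OF assms] by blast
  obtain B where B: "B > 0" "\<And>\<gamma> f x. \<gamma> > 0 \<Longrightarrow> f \<in> holder_densities \<beta> \<gamma> \<Longrightarrow> f x \<le> B * \<gamma> powr (1 / (\<beta> + 1))"
    using holder_densities_le[OF assms] by blast
  define C0 where "C0 = (\<Sum>j=1..N. \<bar>c j\<bar>)"
  \<comment> \<open>Adding 1 permits division by C even if all kernel coefficients vanish.\<close>
  define C where "C = C0 + 1"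
  have C0: "C0 \<ge> 0" by (simp add: C0_def sum_nonneg)
  have C: "C \<ge> 1" "C0 \<le> C" using C0 by (auto simp: C_def)
  \<comment> \<open>Chosen so that V / (h * \<sigma>) bounds the second moment of the kernel, the
    densities being at most B / \<sigma>.\<close>
  define V where "V = B * C\<^sup>2 * real N"
  have V: "V \<ge> 0" using B by (simp add: V_def)
  \<comment> \<open>Makes (E - V / C) / C equal to 2, so that the Chernoff exponent becomes exactly
    2 * ln (1 / \<delta>).\<close>
  define E where "E = 2 * C + V / C"
  have E: "E > 0" using C V by (simp add: E_def add_pos_nonneg)
  show ?thesis
  proof (intro exI[of _ "(4 * (E + 1))\<^sup>2"] conjI allI impI)
    show "(4 * (E + 1))\<^sup>2 > 0" using E by simp
    fix \<gamma> \<delta> x0 :: real and n :: nat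
    assume \<gamma>: "0 < \<gamma>" and n: "1 \<le> n" and \<delta>: "0 < \<delta>" "\<delta> \<le> 1/4" and L: "ln (1 / \<delta>) \<le> real n"
      and ne: "holder_densities \<beta> \<gamma> \<noteq> {}"
    define u where "u = ln (1 / \<delta>) / real n"
    have Lpos: "ln (1 / \<delta>) > 0" using \<delta> by simp
    have u: "0 < u" "u \<le> 1" using Lpos n L by (auto simp: u_def)
    define \<sigma> where "\<sigma> = \<gamma> powr (- (1 / (\<beta> + 1)))"
    define w where "w = u powr (\<beta> / (2 * \<beta> + 1))"
    define h where "h = \<sigma> * u powr (1 / (2 * \<beta> + 1))"
    have \<sigma>: "\<sigma> > 0" using \<gamma> by (simp add: \<sigma>_def)
    have h: "h > 0" and w: "w > 0" using \<sigma> u by (auto simp: h_def w_def)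
    have w1: "w \<le> 1" using u assms by (simp add: w_def powr_le1)
    note inv = bandwidth_identities(1)[OF assms \<gamma> u(1), folded \<sigma>_def]
      and \<gamma>2 = bandwidth_identities(2)[OF assms \<gamma> u(1), folded \<sigma>_def]
      and b = bandwidth_identities(5)[OF assms \<gamma> u(1), folded \<sigma>_def, folded w_def h_def]
      and w2 = bandwidth_identities(6)[OF assms \<gamma> u(1), folded w_def]
      and hw = bandwidth_identities(7)[OF assms \<gamma> u(1), folded \<sigma>_def, folded w_def h_def]
    \<comment> \<open>With \<bar>K\<bar> \<le> C / h this gives \<bar>\<theta> * K\<bar> \<le> w,
      and w \<le> 1 holds because ln (1 / \<delta>) \<le> n.\<close>
    define \<theta> where "\<theta> = h * w / C"
    define K where "K = step_kernel c N h x0"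
    have [measurable]: "K \<in> borel_measurable borel" unfolding K_def by measurable
    have K: "\<bar>K y\<bar> \<le> C / h" for y
      using abs_step_kernel_le[OF h, of c N x0 y] C(2) h unfolding K_def C0_def[symmetric]
      by (meson divide_right_mono less_imp_le order_trans)
    have \<theta>: "\<theta> > 0" using h w C by (simp add: \<theta>_def)
    have \<theta>K: "\<bar>\<theta> * K y\<bar> \<le> 1" for y
    proof -
      have "\<bar>\<theta> * K y\<bar> \<le> \<theta> * (C / h)"
        using \<theta> K[of y] unfolding abs_mult by (intro mult_mono) auto
      also have "\<dots> = w" using C h by (simp add: \<theta>_def)
      finally show ?thesis using w1 by simp
    qed
    define T where "T x = (\<Sum>i<n. K (x i)) / real n" for x :: "nat \<Rightarrow> real"
    define \<epsilon> where "\<epsilon> = (E + 1) * (w / \<sigma>)"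
    have \<epsilon>: "\<epsilon> > 0" using E w \<sigma> by (simp add: \<epsilon>_def)
    have "minimax_quantile \<delta> (sample_space n) (holder_densities \<beta> \<gamma>)
                 (\<lambda>f1 f2. \<bar>f1 x0 - f2 x0\<bar>) (\<lambda>f. {iid_sample n f})
                 (\<lambda>f1 f2. (f1 x0 - f2 x0)\<^sup>2) \<le> ennreal ((4 * \<epsilon>)\<^sup>2)"
    proof (rule minimax_quantile_le_of_real_estimator[where T = T])
      show T: "T \<in> borel_measurable (sample_space n)"
        unfolding T_def[abs_def] sample_space_def by measurable
      fix f assume f: "f \<in> holder_densities \<beta> \<gamma>"
      note fb = holder_densities_basic[OF f]
      show prob: "prob_space (iid_sample n f)" by (intro prob_space_iid_sample fb)
      interpret P: prob_space "iid_sample n f" by (rule prob)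
      have v: "(\<integral>y. f y * (K y)\<^sup>2 \<partial>lborel) \<le> V / (h * \<sigma>)"
      proof -
        have "(\<integral>y. f y * (K y)\<^sup>2 \<partial>lborel) \<le> (B * (1 / \<sigma>)) * C0\<^sup>2 * real N / h"
          unfolding K_def C0_def using B(2)[OF \<gamma> f] fb h
          by (intro step_kernel_second_moment) (auto simp: inv)
        also have "\<dots> = B * C0\<^sup>2 * real N / (h * \<sigma>)" by (simp add: field_simps)
        also have "\<dots> \<le> V / (h * \<sigma>)"
          unfolding V_def using C C0 B h \<sigma>
          by (intro divide_right_mono mult_right_mono mult_left_mono power_mono) auto
        finally show ?thesis .
      qed
      have dev: "real n * \<theta> * (E * (w / \<sigma>) - \<theta> * (V / (h * \<sigma>))) = 2 * ln (1 / \<delta>)"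
      proof -
        have "real n * \<theta> * (E * (w / \<sigma>) - \<theta> * (V / (h * \<sigma>))) = real n * (h * w\<^sup>2) / (C * \<sigma>) * (E - V / C)"
          using h \<sigma> C by (simp add: \<theta>_def field_simps power2_eq_square)
        also have "\<dots> = real n * u * 2"
          unfolding hw E_def using \<sigma> C by simp
        also have "\<dots> = 2 * ln (1 / \<delta>)" using n by (simp add: u_def)
        finally show ?thesis .
      qed
      have "exp (- (2 * ln (1 / \<delta>))) = \<delta>\<^sup>2"
      proof -
        have "- (2 * ln (1 / \<delta>)) = ln \<delta> + ln \<delta>" using \<delta> by (simp add: ln_div)
        then show ?thesis using \<delta> by (simp only: exp_add exp_ln power2_eq_square)
      qed
      \<comment> \<open>Doubling the exponent pays for the factor 2 of the two-sided deviation
        bound.\<close>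
      moreover have "2 * \<delta>\<^sup>2 \<le> \<delta>"
        using \<delta> by (simp add: power2_eq_square)
      ultimately have "1 - \<delta> \<le> 1 - 2 * exp (- (real n * \<theta> * (E * (w / \<sigma>) - \<theta> * (V / (h * \<sigma>)))))"
        unfolding dev by simp
      also have "\<dots> \<le> measure (iid_sample n f)
        {x \<in> space (sample_space n). \<bar>T x - (\<integral>y. f y * K y \<partial>lborel)\<bar> \<le> E * (w / \<sigma>)}"
        unfolding T_def by (rule iid_sample_mean_deviation) (use fb \<theta> \<theta>K v n in auto)
      also have "\<dots> \<le> measure (iid_sample n f) {x \<in> space (sample_space n). \<bar>T x - f x0\<bar> \<le> \<epsilon>}"
      proof (rule P.finite_measure_mono)
        have "\<bar>f x0 - (\<integral>y. f y * K y \<partial>lborel)\<bar> \<le> w / \<sigma>"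
          using bias[OF f h, of x0] \<gamma> b by (simp add: K_def)
        moreover have "\<epsilon> = E * (w / \<sigma>) + w / \<sigma>" unfolding \<epsilon>_def distrib_right by simp
        ultimately show "{x \<in> space (sample_space n). \<bar>T x - (\<integral>y. f y * K y \<partial>lborel)\<bar> \<le> E * (w / \<sigma>)}
          \<subseteq> {x \<in> space (sample_space n). \<bar>T x - f x0\<bar> \<le> \<epsilon>}"
          by auto
        show "{x \<in> space (sample_space n). \<bar>T x - f x0\<bar> \<le> \<epsilon>} \<in> sets (iid_sample n f)"
          unfolding sets_iid_sample using T by measurable
      qed
      finally show "1 - \<delta> \<le> measure (iid_sample n f) {x \<in> space (sample_space n). \<bar>T x - f x0\<bar> \<le> \<epsilon>}" .
    qed (use \<epsilon> ne in auto)
    also have "(4 * \<epsilon>)\<^sup>2 = (4 * (E + 1))\<^sup>2 * (w\<^sup>2 * (1 / \<sigma>)\<^sup>2)"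
      unfolding \<epsilon>_def power_mult_distrib power_divide by simp
    also note \<gamma>2[symmetric]
    finally show "minimax_quantile \<delta> (sample_space n) (holder_densities \<beta> \<gamma>)
                 (\<lambda>f1 f2. \<bar>f1 x0 - f2 x0\<bar>) (\<lambda>f. {iid_sample n f})
                 (\<lambda>f1 f2. (f1 x0 - f2 x0)\<^sup>2)
     \<le> ennreal ((4 * (E + 1))\<^sup>2 * (\<gamma> powr (2 / (\<beta> + 1)) * (ln (1 / \<delta>) / real n) powr (2 * \<beta> / (2 * \<beta> + 1))))"
      by (simp add: w2 u_def mult.commute)
  qed
qed

text \<open>Serves the regime ln (1 / \<delta>) > n: the constant guess 0 is surely within the
  uniform bound on the densities.\<close>

lemma minimax_quantile_upper_trivial:
  assumes "\<beta> > 0"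
  shows "\<exists>C>0. \<forall>\<gamma> n \<delta> x0. 0 < \<gamma> \<longrightarrow> 0 < \<delta> \<longrightarrow> holder_densities \<beta> \<gamma> \<noteq> {} \<longrightarrow>
     minimax_quantile \<delta> (sample_space n) (holder_densities \<beta> \<gamma>)
                 (\<lambda>f1 f2. \<bar>f1 x0 - f2 x0\<bar>) (\<lambda>f. {iid_sample n f})
                 (\<lambda>f1 f2. (f1 x0 - f2 x0)\<^sup>2)
     \<le> ennreal (C * \<gamma> powr (2 / (\<beta> + 1)))"
proof -
  obtain B where B: "B > 0" "\<And>\<gamma> f x. \<gamma> > 0 \<Longrightarrow> f \<in> holder_densities \<beta> \<gamma> \<Longrightarrow> f x \<le> B * \<gamma> powr (1 / (\<beta> + 1))"
    using holder_densities_le[OF assms] by blast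
  show ?thesis
  proof (intro exI[of _ "(4 * B)\<^sup>2"] conjI allI impI)
    show "(4 * B)\<^sup>2 > 0" using B by simp
    fix \<gamma> \<delta> x0 :: real and n :: nat
    assume \<gamma>: "0 < \<gamma>" and \<delta>: "0 < \<delta>" and ne: "holder_densities \<beta> \<gamma> \<noteq> {}"
    define \<epsilon> where "\<epsilon> = B * \<gamma> powr (1 / (\<beta> + 1))"
    have "minimax_quantile \<delta> (sample_space n) (holder_densities \<beta> \<gamma>)
                 (\<lambda>f1 f2. \<bar>f1 x0 - f2 x0\<bar>) (\<lambda>f. {iid_sample n f})
                 (\<lambda>f1 f2. (f1 x0 - f2 x0)\<^sup>2) \<le> ennreal ((4 * \<epsilon>)\<^sup>2)"
    proof (rule minimax_quantile_le_of_real_estimator[where T = "\<lambda>_. 0"])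
      show "\<epsilon> > 0" using B \<gamma> by (simp add: \<epsilon>_def)
      fix f assume f: "f \<in> holder_densities \<beta> \<gamma>"
      note fb = holder_densities_basic[OF f]
      show prob: "prob_space (iid_sample n f)" by (intro prob_space_iid_sample fb)
      interpret P: prob_space "iid_sample n f" by (rule prob)
      have "{x \<in> space (sample_space n). \<bar>0 - f x0\<bar> \<le> \<epsilon>} = space (iid_sample n f)"
        using fb(2)[of x0] B(2)[OF \<gamma> f, of x0] by (auto simp: space_iid_sample \<epsilon>_def)
      then show "1 - \<delta> \<le> measure (iid_sample n f) {x \<in> space (sample_space n). \<bar>0 - f x0\<bar> \<le> \<epsilon>}"
        using \<delta> P.prob_space by simp
    qed (use ne in auto)
    also have "(4 * \<epsilon>)\<^sup>2 = (4 * B)\<^sup>2 * \<gamma> powr (2 / (\<beta> + 1))"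
      by (simp add: \<epsilon>_def power_mult_distrib power2_eq_square powr_add[symmetric] add_divide_distrib[symmetric])
    finally show "minimax_quantile \<delta> (sample_space n) (holder_densities \<beta> \<gamma>)
                 (\<lambda>f1 f2. \<bar>f1 x0 - f2 x0\<bar>) (\<lambda>f. {iid_sample n f})
                 (\<lambda>f1 f2. (f1 x0 - f2 x0)\<^sup>2) \<le> ennreal ((4 * B)\<^sup>2 * \<gamma> powr (2 / (\<beta> + 1)))" .
  qed
qed

subsection \<open>Two-point lower bound\<close>

text \<open>The likelihood ratio of a product is the product of the ratios. By uniqueness of product
  measures it is enough to compare boxes, where the integral factorises and positivity of q cancels
  the denominators.\<close>

lemma iid_sample_eq_density:
  fixes f q :: "real \<Rightarrow> real"
  assumes f: "\<And>x. 0 \<le> f x" "integrable lborel f" "integral\<^sup>L lborel f = 1"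
    and q: "\<And>x. 0 < q x" "integrable lborel q" "integral\<^sup>L lborel q = 1"
  shows "iid_sample n f = density (iid_sample n q) (\<lambda>x. \<Prod>i<n. ennreal (f (x i) / q (x i)))"
proof -
  have [measurable]: "f \<in> borel_measurable borel" "q \<in> borel_measurable borel"
    using f(2) q(2) by auto
  have q0: "\<And>x. 0 \<le> q x" using q(1) less_imp_le by blast
  let ?F = "density lborel (\<lambda>x. ennreal (f x))" and ?Q = "density lborel (\<lambda>x. ennreal (q x))"
  interpret F: prob_space ?F by (intro prob_space_density_lborel f)
  interpret Q: prob_space ?Q by (intro prob_space_density_lborel q q0)
  interpret pF: product_sigma_finite "\<lambda>_::nat. ?F" by standard
  interpret pQ: product_sigma_finite "\<lambda>_::nat. ?Q" by standard
  let ?g = "\<lambda>y. ennreal (f y / q y)"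
  have meas: "(\<lambda>x. \<Prod>i<n. ?g (x i)) \<in> borel_measurable (PiM {..<n} (\<lambda>_. ?Q))"
    by measurable
  have "density (PiM {..<n} (\<lambda>_. ?Q)) (\<lambda>x. \<Prod>i<n. ?g (x i)) = PiM {..<n} (\<lambda>_. ?F)"
  proof (rule pF.PiM_eqI)
    show "sets (density (PiM {..<n} (\<lambda>_. ?Q)) (\<lambda>x. \<Prod>i<n. ?g (x i))) = sets (PiM {..<n} (\<lambda>_. ?F))"
      unfolding sets_density by (rule sets_PiM_cong) auto
    fix A assume A: "\<And>i. i \<in> {..<n} \<Longrightarrow> A i \<in> sets ?F"
    then have A': "\<And>i. i \<in> {..<n} \<Longrightarrow> A i \<in> sets ?Q" by simp
    have box: "Pi\<^sub>E {..<n} A \<in> sets (PiM {..<n} (\<lambda>_. ?Q))"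
      using A' by (intro sets_PiM_I_finite) auto
    \<comment> \<open>The factorisation of the box indicator needs x to be extensional, hence the
      restriction to the product space.\<close>
    have ind: "(\<Prod>i<n. ?g (x i)) * indicator (Pi\<^sub>E {..<n} A) x = (\<Prod>i<n. ?g (x i) * indicator (A i) (x i))"
      if x: "x \<in> space (PiM {..<n} (\<lambda>_. ?Q))" for x
    proof (cases "x \<in> Pi\<^sub>E {..<n} A")
      case True
      then show ?thesis by (auto intro!: prod.cong simp: PiE_iff)
    next
      case False
      then obtain i where "i < n" "x i \<notin> A i"
        using x by (auto simp: space_PiM PiE_iff)
      then have "(\<Prod>i<n. ?g (x i) * indicator (A i) (x i)) = 0"
        by (intro prod_zero bexI[of _ i]) auto
      then show ?thesis using False by simp
    qed
    have "emeasure (density (PiM {..<n} (\<lambda>_. ?Q)) (\<lambda>x. \<Prod>i<n. ?g (x i))) (Pi\<^sub>E {..<n} A)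
        = (\<integral>\<^sup>+ x. (\<Prod>i<n. ?g (x i)) * indicator (Pi\<^sub>E {..<n} A) x \<partial>PiM {..<n} (\<lambda>_. ?Q))"
      by (rule emeasure_density[OF meas box])
    also have "\<dots> = (\<integral>\<^sup>+ x. (\<Prod>i<n. ?g (x i) * indicator (A i) (x i)) \<partial>PiM {..<n} (\<lambda>_. ?Q))"
      by (rule nn_integral_cong) (rule ind)
    also have "\<dots> = (\<Prod>i<n. \<integral>\<^sup>+ y. ?g y * indicator (A i) y \<partial>?Q)"
      using A' by (intro pQ.product_nn_integral_prod) auto
    also have "\<dots> = (\<Prod>i<n. emeasure ?F (A i))"
    proof (rule prod.cong[OF refl])
      fix i assume "i \<in> {..<n}"
      then have [measurable]: "A i \<in> sets borel" using A by simp
      have "(\<integral>\<^sup>+ y. ?g y * indicator (A i) y \<partial>?Q) = (\<integral>\<^sup>+ y. ennreal (q y) * (?g y * indicator (A i) y) \<partial>lborel)"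
        by (subst nn_integral_density) auto
      also have "\<dots> = (\<integral>\<^sup>+ y. ennreal (f y) * indicator (A i) y \<partial>lborel)"
      proof (rule nn_integral_cong)
        fix y
        have "q y \<noteq> 0" using q(1)[of y] by simp
        then have "ennreal (q y) * ?g y = ennreal (f y)"
          using q0[of y] f(1)[of y] by (simp add: ennreal_mult[symmetric])
        then show "ennreal (q y) * (?g y * indicator (A i) y) = ennreal (f y) * indicator (A i) y"
          by (simp add: mult.assoc[symmetric])
      qed
      also have "\<dots> = emeasure ?F (A i)" by (simp add: emeasure_density)
      finally show "(\<integral>\<^sup>+ y. ?g y * indicator (A i) y \<partial>?Q) = emeasure ?F (A i)" .
    qed
    finally show "emeasure (density (PiM {..<n} (\<lambda>_. ?Q)) (\<lambda>x. \<Prod>i<n. ?g (x i))) (Pi\<^sub>E {..<n} A)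
        = (\<Prod>i<n. emeasure ?F (A i))" .
  qed simp
  then show ?thesis by (simp add: iid_sample_def)
qed

text \<open>The parameter \<open>t\<close> linearises the Cauchy--Schwarz bound \<open>P\<^sub>f(A)\<^sup>2 \<le> P\<^sub>q(A) * K ^ n\<close>.\<close>

lemma iid_sample_change_of_measure:
  fixes f q :: "real \<Rightarrow> real"
  assumes f: "\<And>x. 0 \<le> f x" "integrable lborel f" "integral\<^sup>L lborel f = 1"
    and q: "\<And>x. 0 < q x" "integrable lborel q" "integral\<^sup>L lborel q = 1"
    and K: "0 \<le> K" "(\<integral>\<^sup>+ x. ennreal ((f x)\<^sup>2 / q x) \<partial>lborel) \<le> ennreal K"
    and A: "A \<in> sets (sample_space n)" and t: "0 < t"
  shows "2 * measure (iid_sample n f) A \<le> t * measure (iid_sample n q) A + K ^ n / t"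
proof -
  have [measurable]: "f \<in> borel_measurable borel" "q \<in> borel_measurable borel"
    using f(2) q(2) by auto
  have q0: "\<And>x. 0 \<le> q x" using q(1) less_imp_le by blast
  let ?Q = "density lborel (\<lambda>x. ennreal (q x))"
  interpret Q: prob_space ?Q by (intro prob_space_density_lborel q q0)
  interpret pQ: product_sigma_finite "\<lambda>_::nat. ?Q" by standard
  interpret Pf: prob_space "iid_sample n f" by (intro prob_space_iid_sample f)
  interpret Pq: prob_space "iid_sample n q" by (intro prob_space_iid_sample q q0)
  have A': "A \<in> sets (iid_sample n q)" using A by (simp add: sets_iid_sample)
  define G where "G x = (\<Prod>i<n. f (x i) / q (x i))" for x :: "nat \<Rightarrow> real"
  have G0: "0 \<le> G x" for x unfolding G_def using f(1) q0 by (intro prod_nonneg) auto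
  have Gprod: "(\<Prod>i<n. ennreal (f (x i) / q (x i))) = ennreal (G x)" for x
    unfolding G_def using f(1) q0 by (intro prod_ennreal) auto
  have [measurable]: "G \<in> borel_measurable (iid_sample n q)"
    unfolding measurable_iid_sample unfolding sample_space_def G_def[abs_def] by measurable
  \<comment> \<open>The second moment of the likelihood ratio under q factorises into n copies of
    the integral of f^2 / q.\<close>
  have "(\<integral>\<^sup>+ x. ennreal ((G x)\<^sup>2) \<partial>iid_sample n q)
      = (\<integral>\<^sup>+ x. (\<Prod>i<n. ennreal ((f (x i) / q (x i))\<^sup>2)) \<partial>iid_sample n q)"
  proof (rule nn_integral_cong)
    fix x
    show "ennreal ((G x)\<^sup>2) = (\<Prod>i<n. ennreal ((f (x i) / q (x i))\<^sup>2))"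
      unfolding G_def prod_power_distrib by (rule prod_ennreal[symmetric]) simp
  qed
  also have "\<dots> = (\<Prod>i<n. \<integral>\<^sup>+ y. ennreal ((f y / q y)\<^sup>2) \<partial>?Q)"
    unfolding iid_sample_def by (rule pQ.product_nn_integral_prod) auto
  also have "\<dots> \<le> (\<Prod>i<n. ennreal K)"
  proof (rule prod_mono_ennreal)
    have "(\<integral>\<^sup>+ y. ennreal ((f y / q y)\<^sup>2) \<partial>?Q) = (\<integral>\<^sup>+ y. ennreal (q y) * ennreal ((f y / q y)\<^sup>2) \<partial>lborel)"
      by (subst nn_integral_density) auto
    also have "\<dots> = (\<integral>\<^sup>+ x. ennreal ((f x)\<^sup>2 / q x) \<partial>lborel)"
    proof (rule nn_integral_cong)
      fix y
      have "q y * (f y / q y)\<^sup>2 = (f y)\<^sup>2 / q y"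
        using q(1)[of y] by (simp add: power_divide power2_eq_square)
      then show "ennreal (q y) * ennreal ((f y / q y)\<^sup>2) = ennreal ((f y)\<^sup>2 / q y)"
        using q0[of y] by (simp add: ennreal_mult[symmetric])
    qed
    finally show "(\<integral>\<^sup>+ y. ennreal ((f y / q y)\<^sup>2) \<partial>?Q) \<le> ennreal K" using K by simp
  qed
  finally have G2: "(\<integral>\<^sup>+ x. ennreal ((G x)\<^sup>2) \<partial>iid_sample n q) \<le> ennreal (K ^ n)"
    using K by (simp add: ennreal_power)
  have "ennreal (measure (iid_sample n f) A) = emeasure (iid_sample n f) A"
    by (simp add: Pf.emeasure_eq_measure)
  also have "\<dots> = (\<integral>\<^sup>+ x. ennreal (G x) * indicator A x \<partial>iid_sample n q)"
    unfolding iid_sample_eq_density[OF f q, of n] Gprod using A' by (intro emeasure_density) auto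
  also have "\<dots> \<le> (\<integral>\<^sup>+ x. ennreal (t / 2) * indicator A x + ennreal (1 / (2 * t)) * ennreal ((G x)\<^sup>2) \<partial>iid_sample n q)"
  proof (rule nn_integral_mono)
    fix x
    \<comment> \<open>Weighted arithmetic-geometric mean inequality G \<le> t / 2 + G^2 / (2 * t),
      used on A; off A the left-hand side of the goal vanishes.\<close>
    have "0 \<le> (t - G x)\<^sup>2" by simp
    then have "2 * t * G x \<le> t\<^sup>2 + (G x)\<^sup>2" by (simp add: power2_diff)
    then have "G x \<le> t / 2 + 1 / (2 * t) * (G x)\<^sup>2"
      using t by (simp add: field_simps power2_eq_square)
    then show "ennreal (G x) * indicator A x
        \<le> ennreal (t / 2) * indicator A x + ennreal (1 / (2 * t)) * ennreal ((G x)\<^sup>2)"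
      using t G0[of x]
      by (auto simp: ennreal_mult[symmetric] ennreal_plus[symmetric] simp del: ennreal_plus
          split: split_indicator intro!: ennreal_leI)
  qed
  also have "\<dots> = ennreal (t / 2) * emeasure (iid_sample n q) A
      + ennreal (1 / (2 * t)) * (\<integral>\<^sup>+ x. ennreal ((G x)\<^sup>2) \<partial>iid_sample n q)"
    using A' by (subst nn_integral_add) (auto simp: nn_integral_cmult)
  also have "\<dots> \<le> ennreal (t / 2) * emeasure (iid_sample n q) A + ennreal (1 / (2 * t)) * ennreal (K ^ n)"
    by (intro add_left_mono mult_left_mono G2) auto
  also have "\<dots> = ennreal (t / 2 * measure (iid_sample n q) A + 1 / (2 * t) * K ^ n)"
    using t K by (simp add: Pq.emeasure_eq_measure ennreal_mult[symmetric] ennreal_plus[symmetric] del: ennreal_plus)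
  finally have "measure (iid_sample n f) A \<le> t / 2 * measure (iid_sample n q) A + 1 / (2 * t) * K ^ n"
    using t K by (subst (asm) ennreal_le_iff) auto
  then show ?thesis using t by (simp add: field_simps)
qed

lemma quantile_less_imp:
  assumes "quantile \<delta> P Z < ennreal r"
  shows "\<exists>s. 0 \<le> s \<and> s < r \<and> 1 - \<delta> \<le> measure P {x \<in> space P. Z x \<le> s}"
  using assms unfolding quantile_def Inf_less_iff by (auto simp: ennreal_less_iff)

text \<open>An estimator with risk below r at both f and q would succeed on disjoint events. The
  event of success for f then has probability at least 1 - \<delta> under f but at most \<delta>
  under q, which the bounded chi-square integral forbids.\<close>

lemma minimax_quantile_two_point:
  fixes f q :: "real \<Rightarrow> real"
  assumes f: "\<And>x. 0 \<le> f x" "integrable lborel f" "integral\<^sup>L lborel f = 1"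
    and q: "\<And>x. 0 < q x" "integrable lborel q" "integral\<^sup>L lborel q = 1"
    and K: "0 \<le> K" "(\<integral>\<^sup>+ x. ennreal ((f x)\<^sup>2 / q x) \<partial>lborel) \<le> ennreal K"
      "K ^ n \<le> \<delta> powr (- 1 / 2)"
    and \<delta>: "0 < \<delta>" "\<delta> \<le> 1 / 4"
    and \<Theta>: "f \<in> \<Theta>" "q \<in> \<Theta>"
    and sep: "4 * r \<le> (f x0 - q x0)\<^sup>2"
  shows "ennreal r \<le> minimax_quantile \<delta> (sample_space n) \<Theta> d (\<lambda>f. {iid_sample n f})
            (\<lambda>f1 f2. (f1 x0 - f2 x0)\<^sup>2)"
  unfolding minimax_quantile_def
proof (rule INF_greatest, rule ccontr)
  fix est :: "(nat \<Rightarrow> real) \<Rightarrow> real \<Rightarrow> real"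
  interpret Pf: prob_space "iid_sample n f" by (intro prob_space_iid_sample f)
  interpret Pq: prob_space "iid_sample n q" by (intro prob_space_iid_sample q less_imp_le)
  let ?A = "\<lambda>g s. {x \<in> space (sample_space n). (est x x0 - g x0)\<^sup>2 \<le> s}"
  assume "\<not> ennreal r \<le> (SUP \<theta>\<in>\<Theta>. SUP P\<in>{iid_sample n \<theta>}. quantile \<delta> P (\<lambda>x. (est x x0 - \<theta> x0)\<^sup>2))"
  then have less: "(SUP \<theta>\<in>\<Theta>. quantile \<delta> (iid_sample n \<theta>) (\<lambda>x. (est x x0 - \<theta> x0)\<^sup>2)) < ennreal r"
    by simp
  have ex: "\<exists>s. 0 \<le> s \<and> s < r \<and> 1 - \<delta> \<le> measure (iid_sample n g) (?A g s)" if "g \<in> \<Theta>" for g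
  proof -
    have "quantile \<delta> (iid_sample n g) (\<lambda>x. (est x x0 - g x0)\<^sup>2) < ennreal r"
      by (rule le_less_trans[OF SUP_upper[OF that] less])
    from quantile_less_imp[OF this] show ?thesis by (simp add: space_iid_sample)
  qed
  obtain s1 where s1: "s1 < r" and m1: "1 - \<delta> \<le> measure (iid_sample n f) (?A f s1)"
    using ex[OF \<Theta>(1)] by blast
  obtain s2 where s2: "s2 < r" and m2: "1 - \<delta> \<le> measure (iid_sample n q) (?A q s2)"
    using ex[OF \<Theta>(2)] by blast
  \<comment> \<open>The events are measurable because \<open>measure\<close> is 0 outside the
    sigma-algebra, whereas 1 - \<delta> is positive.\<close>
  have A1: "?A f s1 \<in> sets (sample_space n)"
    by (rule ccontr) (use m1 \<delta> measure_notin_sets[of "?A f s1" "iid_sample n f"] in \<open>simp add: sets_iid_sample\<close>)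
  have A2: "?A q s2 \<in> sets (sample_space n)"
    by (rule ccontr) (use m2 \<delta> measure_notin_sets[of "?A q s2" "iid_sample n q"] in \<open>simp add: sets_iid_sample\<close>)
  have disj: "?A f s1 \<inter> ?A q s2 = {}"
  proof safe
    fix x assume le: "(est x x0 - f x0)\<^sup>2 \<le> s1" "(est x x0 - q x0)\<^sup>2 \<le> s2"
    \<comment> \<open>On the intersection (f x0 - q x0)^2 would be at most 2 * s1 + 2 * s2, hence
      below 4 * r, against the separation.\<close>
    have "0 \<le> ((est x x0 - f x0) + (est x x0 - q x0))\<^sup>2" by simp
    then have "(f x0 - q x0)\<^sup>2 \<le> 2 * (est x x0 - f x0)\<^sup>2 + 2 * (est x x0 - q x0)\<^sup>2"
      by (simp add: power2_eq_square algebra_simps)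
    then show "x \<in> {}" using le s1 s2 sep by linarith
  qed
  have "measure (iid_sample n q) (?A f s1) + measure (iid_sample n q) (?A q s2) \<le> 1"
    using A1 A2 disj by (subst Pq.finite_measure_Union[symmetric]) (auto simp: sets_iid_sample)
  then have p1: "measure (iid_sample n q) (?A f s1) \<le> \<delta>" using m2 by linarith
  \<comment> \<open>Balances the two terms: both t * \<delta> and \<delta>^(-1/2) / t equal
    \<delta>^(1/4).\<close>
  define t where "t = \<delta> powr (- 3 / 4)"
  have t: "t > 0" using \<delta> by (simp add: t_def)
  have "2 * measure (iid_sample n f) (?A f s1) \<le> t * measure (iid_sample n q) (?A f s1) + K ^ n / t"
    by (rule iid_sample_change_of_measure[OF f q K(1,2) A1 t])
  also have "\<dots> \<le> t * \<delta> + \<delta> powr (- 1 / 2) / t"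
    using p1 K(3) t by (intro add_mono mult_left_mono divide_right_mono) auto
  also have "t * \<delta> = \<delta> powr (1 / 4)"
  proof -
    have "t * \<delta> = \<delta> powr (- 3 / 4) * \<delta> powr 1" using \<delta> by (simp add: t_def)
    then show ?thesis by (simp only: powr_add[symmetric]) simp
  qed
  also have "\<delta> powr (- 1 / 2) / t = \<delta> powr (1 / 4)"
    unfolding t_def powr_diff[symmetric] by simp
  finally have "measure (iid_sample n f) (?A f s1) \<le> \<delta> powr (1 / 4)" by simp
  then have le: "3 / 4 \<le> \<delta> powr (1 / 4)" using m1 \<delta> by linarith
  \<comment> \<open>(3/4)^4 = 81/256 exceeds 1/4, so the contradiction reaches the endpoint \<delta>
    = 1/4.\<close>
  have "(3 / 4) ^ 4 \<le> (\<delta> powr (1 / 4)) ^ 4" using le by (intro power_mono) auto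
  also have "\<dots> = \<delta>"
    using \<delta> by (simp add: powr_realpow[symmetric] powr_powr)
  finally show False using \<delta> by (simp add: power4_eq_xxxx)
qed

subsection \<open>Gaussian mixtures\<close>

lemma gauss_deriv_0: "gauss_deriv s x0 0 x = exp (- ((x - x0) / s)\<^sup>2)"
  by (simp add: gauss_deriv_def)

lemma gauss_mono:
  assumes "0 < s" "s \<le> s'"
  shows "exp (- ((x - x0) / s)\<^sup>2) \<le> exp (- ((x - x0) / s')\<^sup>2 :: real)"
  using assms by (auto simp: power_divide intro!: divide_left_mono power_mono)

text \<open>S is the width of the base density, which is the case a = 0; h and a are the width and
  amplitude of the perturbation. The weights 2 and - 1 shift the value at x0 by exactly a.\<close>

definition gauss_mixture :: "real \<Rightarrow> real \<Rightarrow> real \<Rightarrow> real \<Rightarrow> real \<Rightarrow> real" where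
  "gauss_mixture S h a x0 x = exp (- ((x - x0) / S)\<^sup>2) / (S * sqrt pi)
     + a * (2 * exp (- ((x - x0) / (h / 2))\<^sup>2) - exp (- ((x - x0) / h)\<^sup>2))"

text \<open>The perturbation has mean zero since halving the scale halves the mass of a Gaussian.\<close>

lemma gauss_mixture_integral:
  assumes "S > 0" "h > 0"
  shows "has_bochner_integral lborel (gauss_mixture S h a x0) 1"
proof -
  have "has_bochner_integral lborel (gauss_mixture S h a x0)
     ((S * sqrt pi) / (S * sqrt pi) + a * (2 * (h / 2 * sqrt pi) - h * sqrt pi))"
    unfolding gauss_mixture_def[abs_def] using assms
    by (intro has_bochner_integral_add has_bochner_integral_diff has_bochner_integral_mult_right
        has_bochner_integral_divide_zero has_bochner_integral_gauss) auto
  then show ?thesis using assms by simp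
qed

text \<open>The narrow Gaussian lies between 0 and the wide one, so twice it minus the wide one lies
  between minus and plus the wide one.\<close>

lemma gauss_mixture_perturbation_le:
  assumes "h > 0"
  shows "\<bar>2 * exp (- ((x - x0) / (h / 2))\<^sup>2) - exp (- ((x - x0) / h)\<^sup>2)\<bar> \<le> exp (- ((x - x0) / h)\<^sup>2 :: real)"
  using gauss_mono[of "h / 2" h x x0] assms by (auto simp: abs_le_iff simp del: exp_le_cancel_iff)

text \<open>The negative part of the perturbation stays below the base density, which is at least as
  wide and as high at its peak.\<close>

lemma gauss_mixture_nonneg:
  assumes "0 < h" "h \<le> S" "0 \<le> a" "a \<le> 1 / (S * sqrt pi)"
  shows "0 \<le> gauss_mixture S h a x0 x"
proof -
  have "a * exp (- ((x - x0) / h)\<^sup>2) \<le> 1 / (S * sqrt pi) * exp (- ((x - x0) / S)\<^sup>2)"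
    using assms by (intro mult_mono gauss_mono) auto
  moreover have "0 \<le> a * (2 * exp (- ((x - x0) / (h / 2))\<^sup>2))" using assms by simp
  ultimately show ?thesis unfolding gauss_mixture_def right_diff_distrib by simp
qed

text \<open>Hoelder constants add up: the base contributes order S^(- \<beta>) times its height, of
  order 1 / S, and the perturbation a * h^(- \<beta>).\<close>

lemma gauss_mixture_in_holder_densities:
  assumes "\<beta> > 0"
  shows "\<exists>B>0. \<forall>\<gamma> S h a x0. 0 < h \<longrightarrow> h \<le> S \<longrightarrow> 0 \<le> a \<longrightarrow> a \<le> 1 / (S * sqrt pi) \<longrightarrow>
    B / S powr (\<beta> + 1) + a * B / h powr \<beta> \<le> \<gamma> \<longrightarrow> gauss_mixture S h a x0 \<in> holder_densities \<beta> \<gamma>"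
proof -
  define m where "m = nat (\<lceil>\<beta>\<rceil> - 1)"
  define \<alpha> where "\<alpha> = \<beta> - real m"
  obtain B0 where B0: "B0 > 0" "\<And>s x0 x y. s > 0 \<Longrightarrow>
      \<bar>gauss_deriv s x0 m x - gauss_deriv s x0 m y\<bar> \<le> B0 / s powr \<beta> * \<bar>x - y\<bar> powr \<alpha>"
    using gauss_deriv_holder[OF assms] unfolding m_def \<alpha>_def by blast
  \<comment> \<open>The Gaussian of scale h / 2 occurs with weight 2 and costs 2^\<beta> more than
    the one of scale h.\<close>
  define B where "B = B0 * (2 * 2 powr \<beta> + 1)"
  have B: "B > 0" "B0 \<le> B"
    using B0(1) by (auto simp: B_def add_pos_pos mult_le_cancel_left1)
  show ?thesis
  proof (intro exI[of _ B] conjI allI impI)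
    fix \<gamma> S h a x0 :: real
    assume h: "0 < h" "h \<le> S" and a: "0 \<le> a" "a \<le> 1 / (S * sqrt pi)"
      and le: "B / S powr (\<beta> + 1) + a * B / h powr \<beta> \<le> \<gamma>"
    have S: "S > 0" using h by simp
    let ?g = "\<lambda>s. gauss_deriv s x0"
    define D where "D k x = ?g S k x / (S * sqrt pi) + a * (2 * ?g (h / 2) k x - ?g h k x)" for k x
    show "gauss_mixture S h a x0 \<in> holder_densities \<beta> \<gamma>"
    proof (rule holder_densitiesI[where D = D])
      show "D 0 = gauss_mixture S h a x0"
        by (auto simp: D_def gauss_deriv_0 gauss_mixture_def)
      show "(D k has_real_derivative D (Suc k) x) (at x)" for k x
        unfolding D_def[abs_def] using S h
        by (intro DERIV_add DERIV_diff DERIV_cmult DERIV_cdivide gauss_deriv_has_derivative) auto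
      show "0 \<le> gauss_mixture S h a x0 x" for x by (rule gauss_mixture_nonneg[OF h a])
      show "has_bochner_integral lborel (gauss_mixture S h a x0) 1"
        by (rule gauss_mixture_integral[OF S h(1)])
      fix x y
      have G: "\<bar>?g s m x - ?g s m y\<bar> \<le> B0 / s powr \<beta> * \<bar>x - y\<bar> powr \<alpha>" if "s > 0" for s
        by (rule B0(2)[OF that])
      have half: "(h / 2) powr \<beta> = h powr \<beta> / 2 powr \<beta>" using h by (simp add: powr_divide)
      have pi1: "1 \<le> sqrt pi" using pi_ge_two by simp
      have "D m x - D m y = (?g S m x - ?g S m y) / (S * sqrt pi)
          + a * (2 * (?g (h / 2) m x - ?g (h / 2) m y) - (?g h m x - ?g h m y))"
        by (simp add: D_def diff_divide_distrib algebra_simps)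
      also have "\<bar>\<dots>\<bar> \<le> \<bar>(?g S m x - ?g S m y) / (S * sqrt pi)\<bar>
          + \<bar>a * (2 * (?g (h / 2) m x - ?g (h / 2) m y) - (?g h m x - ?g h m y))\<bar>"
        by (rule abs_triangle_ineq)
      also have "\<bar>(?g S m x - ?g S m y) / (S * sqrt pi)\<bar> \<le> B / S powr (\<beta> + 1) * \<bar>x - y\<bar> powr \<alpha>"
      proof -
        have "\<bar>(?g S m x - ?g S m y) / (S * sqrt pi)\<bar> = \<bar>?g S m x - ?g S m y\<bar> / (S * sqrt pi)"
          using S by (simp add: abs_divide abs_mult)
        also have "\<dots> \<le> (B / S powr \<beta> * \<bar>x - y\<bar> powr \<alpha>) / (S * 1)"
        proof (rule frac_le)
          show "\<bar>?g S m x - ?g S m y\<bar> \<le> B / S powr \<beta> * \<bar>x - y\<bar> powr \<alpha>"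
            by (rule order_trans[OF G[OF S]]) (intro mult_right_mono divide_right_mono B(2); simp)
          show "S * 1 \<le> S * sqrt pi" using pi1 S by (intro mult_left_mono) auto
        qed (use S B in auto)
        also have "\<dots> = B / S powr (\<beta> + 1) * \<bar>x - y\<bar> powr \<alpha>"
          using S by (simp add: powr_add)
        finally show ?thesis .
      qed
      also have "\<bar>a * (2 * (?g (h / 2) m x - ?g (h / 2) m y) - (?g h m x - ?g h m y))\<bar>
          \<le> a * B / h powr \<beta> * \<bar>x - y\<bar> powr \<alpha>"
      proof -
        have "\<bar>2 * (?g (h / 2) m x - ?g (h / 2) m y) - (?g h m x - ?g h m y)\<bar>
            \<le> 2 * \<bar>?g (h / 2) m x - ?g (h / 2) m y\<bar> + \<bar>?g h m x - ?g h m y\<bar>"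
          using abs_triangle_ineq4[of "2 * (?g (h / 2) m x - ?g (h / 2) m y)"] unfolding abs_mult by simp
        also have "\<dots> \<le> 2 * (B0 / (h / 2) powr \<beta> * \<bar>x - y\<bar> powr \<alpha>) + B0 / h powr \<beta> * \<bar>x - y\<bar> powr \<alpha>"
          using h by (intro add_mono mult_left_mono G) auto
        also have "\<dots> = B / h powr \<beta> * \<bar>x - y\<bar> powr \<alpha>"
          unfolding half B_def by (simp add: algebra_simps add_divide_distrib)
        finally show ?thesis
          using a by (simp add: abs_mult mult_left_mono mult.assoc times_divide_eq_right[symmetric] del: times_divide_eq_right)
      qed
      finally have "\<bar>D m x - D m y\<bar> \<le> (B / S powr (\<beta> + 1) + a * B / h powr \<beta>) * \<bar>x - y\<bar> powr \<alpha>"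
        by (simp add: distrib_right)
      also have "\<dots> \<le> \<gamma> * \<bar>x - y\<bar> powr \<alpha>" by (intro mult_right_mono le) auto
      finally show "\<bar>D (nat (\<lceil>\<beta>\<rceil> - 1)) x - D (nat (\<lceil>\<beta>\<rceil> - 1)) y\<bar>
          \<le> \<gamma> * \<bar>x - y\<bar> powr (\<beta> - real (nat (\<lceil>\<beta>\<rceil> - 1)))"
        by (simp add: \<alpha>_def m_def)
    qed
  qed (rule B(1))
qed

text \<open>Write q for the base, A for its peak and d for the perturbation. Then (q + d)^2 / q = q
  + 2 * d + d^2 / q, where d has integral zero and d^2 is at most a^2 times the product of the
  Gaussians of scales h and S, so that q cancels.\<close>

lemma gauss_mixture_chi_square:
  assumes h: "0 < h" "h \<le> S" and a: "0 \<le> a"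
  shows "(\<integral>\<^sup>+ x. ennreal ((gauss_mixture S h a x0 x)\<^sup>2 / gauss_mixture S h 0 x0 x) \<partial>lborel)
      \<le> ennreal (1 + a\<^sup>2 * pi * S * h)"
proof -
  have S: "S > 0" using h by simp
  define A where "A = 1 / (S * sqrt pi)"
  have A: "A > 0" using S by (simp add: A_def)
  let ?e = "\<lambda>s x. exp (- ((x - x0) / s)\<^sup>2)"
  let ?d = "\<lambda>x. a * (2 * ?e (h / 2) x - ?e h x)"
  \<comment> \<open>As the first summand is already q + d, \<open>?R\<close> is q + 2 * d plus the
    majorant of d^2 / q.\<close>
  let ?R = "\<lambda>x. gauss_mixture S h a x0 x + ?d x + a\<^sup>2 / A * ?e h x"
  have pert: "has_bochner_integral lborel ?d (a * (2 * (h / 2 * sqrt pi) - h * sqrt pi))"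
    using h by (intro has_bochner_integral_diff has_bochner_integral_mult_right has_bochner_integral_gauss) auto
  have "has_bochner_integral lborel ?R
      (1 + a * (2 * (h / 2 * sqrt pi) - h * sqrt pi) + a\<^sup>2 / A * (h * sqrt pi))"
    using h S by (intro has_bochner_integral_add has_bochner_integral_mult_right has_bochner_integral_gauss
        gauss_mixture_integral pert) auto
  moreover have "1 + a * (2 * (h / 2 * sqrt pi) - h * sqrt pi) + a\<^sup>2 / A * (h * sqrt pi) = 1 + a\<^sup>2 * pi * S * h"
    by (simp add: A_def)
  ultimately have R: "has_bochner_integral lborel ?R (1 + a\<^sup>2 * pi * S * h)" by simp
  have le: "(gauss_mixture S h a x0 x)\<^sup>2 / gauss_mixture S h 0 x0 x \<le> ?R x" for x
  proof -
    define q where "q = gauss_mixture S h 0 x0 x"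
    have q: "q = A * ?e S x" by (simp add: q_def gauss_mixture_def A_def)
    have q0: "q > 0" using A by (simp add: q)
    have f: "gauss_mixture S h a x0 x = q + ?d x" by (simp add: q_def gauss_mixture_def)
    have "(?d x)\<^sup>2 \<le> (a * ?e h x)\<^sup>2"
      using gauss_mixture_perturbation_le[OF h(1), of x x0] a
      by (intro power2_le_iff_abs_le[THEN iffD2]) (auto simp: abs_mult mult_left_mono)
    also have "\<dots> = a\<^sup>2 * ?e h x * ?e h x" by (simp add: power2_eq_square)
    also have "\<dots> \<le> a\<^sup>2 * ?e h x * ?e S x" using h by (intro mult_left_mono gauss_mono) auto
    also have "\<dots> = a\<^sup>2 / A * ?e h x * q" using A by (simp add: q)
    finally have "(?d x)\<^sup>2 / q \<le> a\<^sup>2 / A * ?e h x" using q0 by (simp add: pos_divide_le_eq)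
    moreover have "(q + ?d x)\<^sup>2 / q = q + ?d x + ?d x + (?d x)\<^sup>2 / q"
    proof -
      have *: "(q + z)\<^sup>2 / q = q + z + z + z\<^sup>2 / q" for z
        using q0 by (simp add: field_simps power2_eq_square)
      show ?thesis by (rule *)
    qed
    ultimately show ?thesis unfolding q_def[symmetric] f by linarith
  qed
  have q_nonneg: "0 \<le> gauss_mixture S h 0 x0 x" for x
    using S by (intro gauss_mixture_nonneg h) auto
  have "(\<integral>\<^sup>+ x. ennreal ((gauss_mixture S h a x0 x)\<^sup>2 / gauss_mixture S h 0 x0 x) \<partial>lborel)
      \<le> (\<integral>\<^sup>+ x. ennreal (?R x) \<partial>lborel)"
    by (intro nn_integral_mono ennreal_leI le)
  also have "\<dots> = ennreal (integral\<^sup>L lborel ?R)"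
  proof (rule nn_integral_eq_integral)
    show "integrable lborel ?R" using R by (simp only: has_bochner_integral_iff)
    show "AE x in lborel. 0 \<le> ?R x"
      by (rule AE_I2) (rule order_trans[OF divide_nonneg_nonneg[OF zero_le_power2 q_nonneg] le])
  qed
  also have "integral\<^sup>L lborel ?R = 1 + a\<^sup>2 * pi * S * h"
    using R by (simp only: has_bochner_integral_iff)
  finally show ?thesis .
qed

text \<open>Base and perturbed Gaussian each use at most half of the allowed constant \<gamma> for
  their Hoelder contribution and differ by a at x0. Nonemptiness of the class is recorded here since
  the upper bounds need a default member.\<close>

lemma minimax_quantile_lower:
  assumes "\<beta> > 0"
  shows "\<exists>c>0. \<forall>\<gamma> n \<delta> x0. 0 < \<gamma> \<longrightarrow> 1 \<le> n \<longrightarrow> 0 < \<delta> \<longrightarrow> \<delta> \<le> 1 / 4 \<longrightarrow>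
     holder_densities \<beta> \<gamma> \<noteq> {} \<and>
     ennreal (c * (\<gamma> powr (2 / (\<beta> + 1)) * (min (ln (1 / \<delta>) / real n) 1) powr (2 * \<beta> / (2 * \<beta> + 1))))
     \<le> minimax_quantile \<delta> (sample_space n) (holder_densities \<beta> \<gamma>)
                 (\<lambda>f1 f2. \<bar>f1 x0 - f2 x0\<bar>) (\<lambda>f. {iid_sample n f})
                 (\<lambda>f1 f2. (f1 x0 - f2 x0)\<^sup>2)"
proof -
  obtain B where B: "B > 0" and holder: "\<And>\<gamma> S h a x0. 0 < h \<Longrightarrow> h \<le> S \<Longrightarrow> 0 \<le> a \<Longrightarrow> a \<le> 1 / (S * sqrt pi) \<Longrightarrow>
    B / S powr (\<beta> + 1) + a * B / h powr \<beta> \<le> \<gamma> \<Longrightarrow> gauss_mixture S h a x0 \<in> holder_densities \<beta> \<gamma>"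
    using gauss_mixture_in_holder_densities[OF assms] by blast
  \<comment> \<open>W \<ge> 1 gives h \<le> \<sigma> \<le> S; W \<ge> 2 * B makes the base
    contribute at most \<gamma> / 2.\<close>
  define W where "W = max 1 (2 * B)"
  have W: "W \<ge> 1" "2 * B \<le> W" by (auto simp: W_def)
  \<comment> \<open>The first bound yields nonnegativity (with sqrt pi \<le> 8) and W * a0 \<le> 1 /
    8, hence chi-square excess at most u / 2; the second limits the perturbation to \<gamma> /
    2.\<close>
  define a0 where "a0 = min (1 / (8 * W)) (1 / (2 * B))"
  have a0: "a0 > 0" "a0 \<le> 1 / (8 * W)" "a0 \<le> 1 / (2 * B)" using W B by (auto simp: a0_def)
  have pi4: "sqrt pi \<le> 2" by (rule real_le_lsqrt) (use pi_less_4 in auto)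
  \<comment> \<open>The separation is a = a0 * w / \<sigma>, and the two-point bound needs 4 * r
    \<le> a^2, hence the constant (a0 / 2)^2.\<close>
  show ?thesis
  proof (intro exI[of _ "(a0 / 2)\<^sup>2"] conjI[of "0 < _"] allI impI)
    show "(a0 / 2)\<^sup>2 > 0" using a0 by simp
    fix \<gamma> \<delta> x0 :: real and n :: nat
    assume \<gamma>: "0 < \<gamma>" and n: "1 \<le> n" and \<delta>: "0 < \<delta>" "\<delta> \<le> 1/4"
    \<comment> \<open>Truncation at 1 keeps h \<le> \<sigma> and w \<le> 1 for every n and \<delta>,
      so one construction covers both regimes.\<close>
    define u where "u = min (ln (1 / \<delta>) / real n) 1"
    have Lpos: "ln (1 / \<delta>) > 0" using \<delta> by simp
    have u: "0 < u" "u \<le> 1" "u \<le> ln (1 / \<delta>) / real n" using Lpos n by (auto simp: u_def)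
    define \<sigma> where "\<sigma> = \<gamma> powr (- (1 / (\<beta> + 1)))"
    define w where "w = u powr (\<beta> / (2 * \<beta> + 1))"
    define h where "h = \<sigma> * u powr (1 / (2 * \<beta> + 1))"
    define a where "a = a0 * w / \<sigma>"
    define S where "S = W * \<sigma>"
    have \<sigma>: "\<sigma> > 0" using \<gamma> by (simp add: \<sigma>_def)
    have w: "w > 0" "w \<le> 1" using u assms by (auto simp: w_def powr_le1)
    have S: "S > 0" using W \<sigma> by (simp add: S_def)
    have hS: "0 < h" "h \<le> S"
    proof -
      show "0 < h" using \<sigma> u by (simp add: h_def)
      have "h \<le> \<sigma> * 1" unfolding h_def using \<sigma> u assms by (intro mult_left_mono powr_le1) auto
      also have "\<dots> \<le> S" unfolding S_def using W \<sigma> by simp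
      finally show "h \<le> S" .
    qed
    note \<gamma>2 = bandwidth_identities(2)[OF assms \<gamma> u(1), folded \<sigma>_def]
      and \<gamma>\<sigma> = bandwidth_identities(3)[OF assms \<gamma> u(1), folded \<sigma>_def]
      and h_powr = bandwidth_identities(4)[OF assms \<gamma> u(1), folded \<sigma>_def, folded w_def h_def]
      and w2 = bandwidth_identities(6)[OF assms \<gamma> u(1), folded w_def]
      and hw = bandwidth_identities(7)[OF assms \<gamma> u(1), folded \<sigma>_def, folded w_def h_def]
    have a: "0 < a" "a \<le> 1 / (S * sqrt pi)"
    proof -
      show "0 < a" using a0 w \<sigma> by (simp add: a_def)
      have "a \<le> 1 / (8 * W) * 1 / \<sigma>"
        unfolding a_def using a0 w \<sigma> W by (intro divide_right_mono mult_mono) auto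
      also have "\<dots> = 1 / (S * 8)" by (simp add: S_def)
      also have "\<dots> \<le> 1 / (S * sqrt pi)"
        using S pi4 by (intro divide_left_mono mult_left_mono) auto
      finally show "a \<le> 1 / (S * sqrt pi)" .
    qed
    have base: "B / S powr (\<beta> + 1) \<le> \<gamma> / 2"
    proof -
      have "W powr 1 \<le> W powr (\<beta> + 1)" using W assms by (intro powr_mono) auto
      then have "2 * B \<le> W powr (\<beta> + 1)" using W by simp
      then have "B / W powr (\<beta> + 1) \<le> 1 / 2" using W by (simp add: pos_divide_le_eq)
      moreover have "B / S powr (\<beta> + 1) = B / W powr (\<beta> + 1) * \<gamma>"
        using W \<sigma> \<gamma> by (simp add: S_def powr_mult \<gamma>\<sigma>)
      ultimately show ?thesis using \<gamma> mult_right_mono[of "B / W powr (\<beta> + 1)" "1 / 2" \<gamma>] by simp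
    qed
    have pert: "a * B / h powr \<beta> \<le> \<gamma> / 2"
    proof -
      have "a * B / h powr \<beta> = a0 * B / \<sigma> powr (\<beta> + 1)"
        using w \<sigma> unfolding h_powr by (simp add: a_def powr_add)
      also have "\<dots> = a0 * B * \<gamma>" using \<gamma> by (simp add: \<gamma>\<sigma>)
      also have "\<dots> \<le> 1 / (2 * B) * B * \<gamma>"
        using a0 B \<gamma> by (intro mult_right_mono) auto
      also have "\<dots> = \<gamma> / 2" using B by simp
      finally show ?thesis .
    qed
    define f where "f = gauss_mixture S h a x0"
    define q where "q = gauss_mixture S h 0 x0"
    have f: "f \<in> holder_densities \<beta> \<gamma>"
      unfolding f_def using add_mono[OF base pert] by (intro holder hS a less_imp_le[OF a(1)]) simp
    have q: "q \<in> holder_densities \<beta> \<gamma>"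
    proof -
      have "B / S powr (\<beta> + 1) + 0 * B / h powr \<beta> \<le> \<gamma>" using base \<gamma> by linarith
      then show ?thesis unfolding q_def using S by (intro holder hS) auto
    qed
    show "holder_densities \<beta> \<gamma> \<noteq> {} \<and>
      ennreal ((a0 / 2)\<^sup>2 * (\<gamma> powr (2 / (\<beta> + 1)) * (min (ln (1 / \<delta>) / real n) 1) powr (2 * \<beta> / (2 * \<beta> + 1))))
     \<le> minimax_quantile \<delta> (sample_space n) (holder_densities \<beta> \<gamma>)
                 (\<lambda>f1 f2. \<bar>f1 x0 - f2 x0\<bar>) (\<lambda>f. {iid_sample n f})
                 (\<lambda>f1 f2. (f1 x0 - f2 x0)\<^sup>2)"
    proof (intro conjI minimax_quantile_two_point[where f = f and q = q and K = "1 + u / 2"])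
      show "holder_densities \<beta> \<gamma> \<noteq> {}" using f by blast
      show "0 \<le> f x" for x using holder_densities_basic[OF f] by blast
      show "integrable lborel f" "integral\<^sup>L lborel f = 1" using holder_densities_basic[OF f] by auto
      show "0 < q x" for x using S by (simp add: q_def gauss_mixture_def)
      show "integrable lborel q" "integral\<^sup>L lborel q = 1" using holder_densities_basic[OF q] by auto
      show "0 \<le> 1 + u / 2" using u by simp
      show "(\<integral>\<^sup>+ x. ennreal ((f x)\<^sup>2 / q x) \<partial>lborel) \<le> ennreal (1 + u / 2)"
      proof -
        have "a\<^sup>2 * pi * S * h = pi * W * a0\<^sup>2 * (h * w\<^sup>2) / \<sigma>"
          using \<sigma> by (simp add: a_def S_def power2_eq_square field_simps)
        also have "\<dots> = pi * (W * a0) * a0 * u" unfolding hw using \<sigma> by (simp add: power2_eq_square)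
        also have "\<dots> \<le> 4 * (1 / 8) * 1 * u"
        proof (intro mult_right_mono mult_mono)
          show "pi \<le> 4" using pi_less_4 by simp
          show "W * a0 \<le> 1 / 8" using mult_left_mono[OF a0(2), of W] W by simp
          have "1 / (8 * W) \<le> 1" using W by simp
          then show "a0 \<le> 1" using a0(2) by linarith
        qed (use W a0 u in auto)
        finally have "1 + a\<^sup>2 * pi * S * h \<le> 1 + u / 2" by simp
        then show ?thesis
          using gauss_mixture_chi_square[OF hS, of a x0] a unfolding f_def q_def
          by (meson ennreal_leI less_imp_le order_trans)
      qed
      show "(1 + u / 2) ^ n \<le> \<delta> powr (- 1 / 2)"
      proof -
        have "(1 + u / 2) ^ n \<le> exp (u / 2) ^ n"
          using u by (intro power_mono exp_ge_add_one_self) auto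
        also have "\<dots> = exp (real n * (u / 2))" by (rule exp_of_nat_mult[symmetric])
        also have "\<dots> \<le> exp (- 1 / 2 * ln \<delta>)"
        proof -
          have "real n * u \<le> ln (1 / \<delta>)" using u(3) n by (simp add: field_simps)
          then show ?thesis using \<delta> by (simp add: ln_div)
        qed
        also have "\<dots> = \<delta> powr (- 1 / 2)" using \<delta> by (simp add: powr_def)
        finally show ?thesis .
      qed
      show "4 * ((a0 / 2)\<^sup>2 * (\<gamma> powr (2 / (\<beta> + 1)) * (min (ln (1 / \<delta>) / real n) 1) powr (2 * \<beta> / (2 * \<beta> + 1)))) \<le> (f x0 - q x0)\<^sup>2"
      proof -
        have "f x0 - q x0 = a" by (simp add: f_def q_def gauss_mixture_def)
        then show ?thesis
          unfolding u_def[symmetric] w2[symmetric] \<gamma>2 by (simp add: a_def power_divide power_mult_distrib)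
      qed
    qed (use f q \<delta> in auto)
  qed
qed

section \<open>The two-sided rate\<close>

theorem proposition15:
  fixes \<beta> :: real
  assumes "\<beta> > 0"
  shows "\<exists>c C :: real. 0 < c \<and> 0 < C \<and>
    (\<forall>(\<gamma>::real) (n::nat) (\<delta>::real) (x0::real).
      0 < \<gamma> \<longrightarrow> 1 \<le> n \<longrightarrow> 0 < \<delta> \<longrightarrow> \<delta> \<le> 1 / 4 \<longrightarrow>
      (let M = minimax_quantile \<delta> (sample_space n) (holder_densities \<beta> \<gamma>)
                 (\<lambda>f1 f2. \<bar>f1 x0 - f2 x0\<bar>) (\<lambda>f. {iid_sample n f})
                 (\<lambda>f1 f2. (f1 x0 - f2 x0)\<^sup>2);
           rate = \<gamma> powr (2 / (\<beta> + 1)) *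
                  min ((ln (1 / \<delta>) / real n) powr (2 * \<beta> / (2 * \<beta> + 1))) 1
       in ennreal (c * rate) \<le> M \<and> M \<le> ennreal (C * rate)))"
proof -
  let ?M = "\<lambda>\<gamma> n \<delta> x0. minimax_quantile \<delta> (sample_space n) (holder_densities \<beta> \<gamma>)
                 (\<lambda>f1 f2. \<bar>f1 x0 - f2 x0\<bar>) (\<lambda>f. {iid_sample n f})
                 (\<lambda>f1 f2. (f1 x0 - f2 x0)\<^sup>2)"
  let ?e = "2 * \<beta> / (2 * \<beta> + 1)"
  from minimax_quantile_lower[OF assms] obtain c where c: "c > 0"
    and lower: "\<And>\<gamma> n \<delta> x0. 0 < \<gamma> \<Longrightarrow> 1 \<le> n \<Longrightarrow> 0 < \<delta> \<Longrightarrow> \<delta> \<le> 1 / 4 \<Longrightarrow>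
     holder_densities \<beta> \<gamma> \<noteq> {} \<and>
     ennreal (c * (\<gamma> powr (2 / (\<beta> + 1)) * (min (ln (1 / \<delta>) / real n) 1) powr ?e)) \<le> ?M \<gamma> n \<delta> x0"
    by blast
  from minimax_quantile_upper_kernel[OF assms] obtain C1 where C1: "C1 > 0"
    and kernel: "\<And>\<gamma> n \<delta> x0. 0 < \<gamma> \<Longrightarrow> 1 \<le> n \<Longrightarrow> 0 < \<delta> \<Longrightarrow> \<delta> \<le> 1 / 4 \<Longrightarrow> ln (1 / \<delta>) \<le> real n \<Longrightarrow>
     holder_densities \<beta> \<gamma> \<noteq> {} \<Longrightarrow>
     ?M \<gamma> n \<delta> x0 \<le> ennreal (C1 * (\<gamma> powr (2 / (\<beta> + 1)) * (ln (1 / \<delta>) / real n) powr ?e))"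
    by blast
  from minimax_quantile_upper_trivial[OF assms] obtain C2 where C2: "C2 > 0"
    and trivial: "\<And>\<gamma> n \<delta> x0. 0 < \<gamma> \<Longrightarrow> 0 < \<delta> \<Longrightarrow> holder_densities \<beta> \<gamma> \<noteq> {} \<Longrightarrow>
     ?M \<gamma> n \<delta> x0 \<le> ennreal (C2 * \<gamma> powr (2 / (\<beta> + 1)))"
    by blast
  show ?thesis
  proof (rule exI[of _ c], rule exI[of _ "max C1 C2"], intro conjI allI impI)
    show "0 < c" "0 < max C1 C2" using c C1 by auto
    fix \<gamma> \<delta> x0 :: real and n :: nat
    assume \<gamma>: "0 < \<gamma>" and n: "1 \<le> n" and \<delta>: "0 < \<delta>" "\<delta> \<le> 1/4"
    define u where "u = ln (1 / \<delta>) / real n"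
    define g where "g = \<gamma> powr (2 / (\<beta> + 1))"
    have u: "u > 0" using \<delta> n by (simp add: u_def)
    have g: "g > 0" using \<gamma> by (simp add: g_def)
    have e: "0 \<le> ?e" using assms by simp
    \<comment> \<open>The lower bound truncates before taking the power and the theorem afterwards;
      the two agree as the exponent is nonnegative.\<close>
    have min_eq: "(min u 1) powr ?e = min (u powr ?e) 1"
      using u e powr_le1[of ?e u] ge_one_powr_ge_zero[of u ?e]
      by (cases "u \<le> 1") (auto simp: min_def)
    note low = lower[OF \<gamma> n \<delta>, of x0]
    have "?M \<gamma> n \<delta> x0 \<le> ennreal (max C1 C2 * (g * min (u powr ?e) 1))"
    proof (cases "u \<le> 1")
      case True
      then have "ln (1 / \<delta>) \<le> real n" using n by (simp add: u_def)
      then have "?M \<gamma> n \<delta> x0 \<le> ennreal (C1 * (g * u powr ?e))"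
        unfolding g_def u_def using low by (intro kernel \<gamma> n \<delta>) auto
      also have "C1 * (g * u powr ?e) \<le> max C1 C2 * (g * u powr ?e)"
        using g by (intro mult_right_mono) auto
      also have "u powr ?e = min (u powr ?e) 1" unfolding min_eq[symmetric] using True by simp
      finally show ?thesis by (simp add: ennreal_leI)
    next
      case False
      have "?M \<gamma> n \<delta> x0 \<le> ennreal (C2 * g)"
        unfolding g_def using low by (intro trivial \<gamma> \<delta>) auto
      also have "C2 * g \<le> max C1 C2 * g" using g by (intro mult_right_mono) auto
      also have "max C1 C2 * g = max C1 C2 * (g * min (u powr ?e) 1)"
        unfolding min_eq[symmetric] using False by simp
      finally show ?thesis by (simp add: ennreal_leI)
    qed
    then show "let M = ?M \<gamma> n \<delta> x0;
           rate = \<gamma> powr (2 / (\<beta> + 1)) * min ((ln (1 / \<delta>) / real n) powr ?e) 1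
       in ennreal (c * rate) \<le> M \<and> M \<le> ennreal (max C1 C2 * rate)"
      using low by (simp add: Let_def g_def u_def[symmetric] min_eq)
  qed
qed

end
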